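(* Let $\Delta$ be a finite connected graph and let $G\leq \operatorname{Aut}(\Delta)$ be a group of automorphisms of $\Delta$. Suppose that for each vertex $v$ of $\Delta$ the group $G_v^{\Delta(v)}$ is transitive on $\Delta(v)$ and the following two conditions hold: (i) $(C_{G_v}(G_v^{[1]}))^{\Delta(v)}$ is transitive or semiregular on $\Delta(v)$; (ii) for each prime $q$, the group $\langle O_q(G_{v,w})\mid w\in\Delta(v)\rangle^{\Delta(v)}$ is transitive or semiregular on $\Delta(v)$. Let $(x,y)$ be an arc of $\Delta$. Then there is a prime $p$ such that both of the following hold. (1) Either $G_{x,y}^{[1]}$ is a $p$-group, or (interchanging $x$ and $y$ if necessary) $G_{x,y}^{[1]}=G_x^{[2]}$ and the group $G_y^{[2]}=G_y^{[3]}$ is a $p$-group. (2) Either $F^*(G_{x,y})$ is a $p$-group, or (interchanging $x$ and $y$ if necessary) $G_{x,y}^{[1]}=G_x^{[2]}$ and $G_y^{[2]}=1$.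
   Context: Graphs are undirected, and an arc is an ordered pair of adjacent vertices. For a vertex $z$, $\Delta(z)$ is the set of vertices adjacent to $z$, $G_z$ is the stabiliser of $z$ in $G$, and for $i\ge 0$, $G_z^{[i]}$ is the subgroup of $G_z$ of elements fixing every vertex at distance at most $i$ from $z$. For an arc $(x,y)$, $G_{x,y}=G_x\cap G_y$ and $G_{x,y}^{[1]}=G_x^{[1]}\cap G_y^{[1]}$. For a subgroup $X\le G_z$, $X^{\Delta(z)}$ is the permutation group induced by $X$ on $\Delta(z)$. A permutation group is semiregular if the identity is its only element fixing some point. $C_{A}(B)$ is the centraliser, $O_q(A)$ is the largest normal $q$-subgroup of $A$, and $F^*(A)$ is the generalised Fitting subgroup of $A$. The trivial group is a $p$-group for every prime $p$. In (1) and in (2), "interchanging $x$ and $y$ if necessary" means that the displayed alternative holds for $(x,y)$ or holds with the roles of $x$ and $y$ swapped; the choice in (1) and in (2) may be made independently. *)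

theory Defs
  imports
    "HOL-Algebra.Group_Action"
    "HOL-Algebra.Generated_Groups"
    "HOL-Algebra.SimpleGroups"
    "HOL-Algebra.SndIsomorphismGrp"
    "HOL-Computational_Algebra.Primes"
    "Graph_Theory.Digraph_Component"
    "Graph_Theory.Shortest_Path"
begin

section \<open>Group theory\<close>

text \<open>For infinite groups \<open>order\<close> is \<open>0\<close>, so the following is the notion of a finite \<open>p\<close>-group
  (\<open>p\<close> prime). The trivial group is a \<open>p\<close>-group for every \<open>p\<close>.\<close>

definition p_group :: "nat \<Rightarrow> ('a, 'm) monoid_scheme \<Rightarrow> bool" where
  "p_group p A \<longleftrightarrow> group A \<and> (\<exists>n::nat. order A = p ^ n)"

text \<open>The largest normal \<open>q\<close>-subgroup \<open>O\<^sub>q(A)\<close>; see \<open>p_core_greatest\<close> for its existence in finite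
  groups.\<close>

definition p_core :: "nat \<Rightarrow> ('a, 'm) monoid_scheme \<Rightarrow> 'a set" where
  "p_core q A = (GREATEST N. N \<lhd> A \<and> p_group q (A\<lparr>carrier := N\<rparr>))"

definition centraliser :: "('a, 'm) monoid_scheme \<Rightarrow> 'a set \<Rightarrow> 'a set" where
  "centraliser A B = {a \<in> carrier A. \<forall>b\<in>B. a \<otimes>\<^bsub>A\<^esub> b = b \<otimes>\<^bsub>A\<^esub> a}"

primrec lower_central :: "('a, 'm) monoid_scheme \<Rightarrow> nat \<Rightarrow> 'a set" where
  "lower_central A 0 = carrier A"
| "lower_central A (Suc n) = generate A
     {h \<otimes>\<^bsub>A\<^esub> g \<otimes>\<^bsub>A\<^esub> inv\<^bsub>A\<^esub> h \<otimes>\<^bsub>A\<^esub> inv\<^bsub>A\<^esub> g | h g. h \<in> lower_central A n \<and> g \<in> carrier A}"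

definition nilpotent :: "('a, 'm) monoid_scheme \<Rightarrow> bool" where
  "nilpotent A \<longleftrightarrow> group A \<and> (\<exists>n. lower_central A n = {\<one>\<^bsub>A\<^esub>})"

text \<open>In a finite group this is the largest normal nilpotent subgroup.\<close>

definition fitting :: "('a, 'm) monoid_scheme \<Rightarrow> 'a set" where
  "fitting A = generate A (\<Union>{N. N \<lhd> A \<and> nilpotent (A\<lparr>carrier := N\<rparr>)})"

inductive subnormal :: "('a, 'm) monoid_scheme \<Rightarrow> 'a set \<Rightarrow> bool" for A where
  whole: "subnormal A (carrier A)"
| step: "subnormal A K \<Longrightarrow> H \<lhd> A\<lparr>carrier := K\<rparr> \<Longrightarrow> subnormal A H"

text \<open>Perfect, and simple modulo the centre; since a quotient of a perfect group is perfect, the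
  simple quotient is automatically non-abelian.\<close>

definition quasisimple :: "('a, 'm) monoid_scheme \<Rightarrow> bool" where
  "quasisimple A \<longleftrightarrow> group A \<and> derived A (carrier A) = carrier A \<and>
     simple_group (A Mod centraliser A (carrier A))"

text \<open>The layer \<open>E(A)\<close>, generated by the components of \<open>A\<close>, and \<open>F\<^sup>*(A) = F(A) E(A)\<close>.\<close>

definition layer :: "('a, 'm) monoid_scheme \<Rightarrow> 'a set" where
  "layer A = generate A (\<Union>{K. subnormal A K \<and> quasisimple (A\<lparr>carrier := K\<rparr>)})"

definition generalised_fitting :: "('a, 'm) monoid_scheme \<Rightarrow> 'a set" where
  "generalised_fitting A = fitting A <#>\<^bsub>A\<^esub> layer A"

text \<open>Elements of \<open>BijGroup S\<close> are extensional functions, whence the restriction in \<open>induced\<close>.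
  Permutation groups on \<open>S\<close> are represented as \<open>BijGroup S\<lparr>carrier := X\<rparr>\<close>.\<close>

abbreviation perm_group :: "'a set \<Rightarrow> ('a \<Rightarrow> 'a) set \<Rightarrow> ('a \<Rightarrow> 'a) monoid" where
  "perm_group S X \<equiv> BijGroup S\<lparr>carrier := X\<rparr>"

definition induced :: "('a \<Rightarrow> 'a) set \<Rightarrow> 'a set \<Rightarrow> ('a \<Rightarrow> 'a) set" where
  "induced X S = (\<lambda>g. restrict g S) ` X"

definition transitive_perm :: "('a \<Rightarrow> 'a) set \<Rightarrow> 'a set \<Rightarrow> bool" where
  "transitive_perm X S \<longleftrightarrow> transitive_action (perm_group S X) S (\<lambda>g. g)"

definition semiregular_perm :: "('a \<Rightarrow> 'a) set \<Rightarrow> 'a set \<Rightarrow> bool" where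
  "semiregular_perm X S \<longleftrightarrow> (\<forall>g\<in>X. (\<exists>a\<in>S. g a = a) \<longrightarrow> g = \<one>\<^bsub>BijGroup S\<^esub>)"


section \<open>Groups of automorphisms of graphs\<close>

text \<open>An undirected graph is a symmetric digraph. It has no parallel arcs (locale \<open>graph\<close>), so
  its automorphisms are the adjacency-preserving permutations of the vertices.\<close>

definition graph_auto :: "('a, 'b) pre_digraph \<Rightarrow> ('a \<Rightarrow> 'a) set" where
  "graph_auto D =
     {f \<in> Bij (verts D). \<forall>u\<in>verts D. \<forall>v\<in>verts D. f u \<rightarrow>\<^bsub>D\<^esub> f v \<longleftrightarrow> u \<rightarrow>\<^bsub>D\<^esub> v}"

definition neighbours :: "('a, 'b) pre_digraph \<Rightarrow> 'a \<Rightarrow> 'a set" where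
  "neighbours D z = {w. z \<rightarrow>\<^bsub>D\<^esub> w}"

definition graph_dist :: "('a, 'b) pre_digraph \<Rightarrow> 'a \<Rightarrow> 'a \<Rightarrow> ereal" where
  "graph_dist D = wf_digraph.\<mu> D (\<lambda>_. 1)"

text \<open>In the following \<open>G\<close> is a group of automorphisms. \<open>ball_stab D G i z\<close> is \<open>G\<^sub>z\<close> with exponent
  \<open>[i]\<close>, and \<open>arc_kernel D G x y\<close> is \<open>G\<close> with index \<open>x,y\<close> and exponent \<open>[1]\<close>.\<close>

definition stab :: "('a \<Rightarrow> 'a) set \<Rightarrow> 'a \<Rightarrow> ('a \<Rightarrow> 'a) set" where
  "stab G z = {g \<in> G. g z = z}"

definition arc_stab :: "('a \<Rightarrow> 'a) set \<Rightarrow> 'a \<Rightarrow> 'a \<Rightarrow> ('a \<Rightarrow> 'a) set" where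
  "arc_stab G x y = stab G x \<inter> stab G y"

definition ball_stab ::
  "('a, 'b) pre_digraph \<Rightarrow> ('a \<Rightarrow> 'a) set \<Rightarrow> nat \<Rightarrow> 'a \<Rightarrow> ('a \<Rightarrow> 'a) set" where
  "ball_stab D G i z = {g \<in> stab G z. \<forall>w\<in>verts D. graph_dist D z w \<le> i \<longrightarrow> g w = w}"

definition arc_kernel ::
  "('a, 'b) pre_digraph \<Rightarrow> ('a \<Rightarrow> 'a) set \<Rightarrow> 'a \<Rightarrow> 'a \<Rightarrow> ('a \<Rightarrow> 'a) set" where
  "arc_kernel D G x y = ball_stab D G 1 x \<inter> ball_stab D G 1 y"


section \<open>Well-definedness\<close>

lemma (in wf_digraph) graph_dist_le_iff:
  "graph_dist G u v \<le> ereal (real i) \<longleftrightarrow> (\<exists>p. awalk u p v \<and> length p \<le> i)"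
proof
  have cost: "awalk_cost (\<lambda>_. 1) p = real (length p)" for p
    by (induct p) auto
  have eq: "graph_dist G u v = (INF p\<in>{p. awalk u p v}. ereal (real (length p)))"
    by (simp add: graph_dist_def \<mu>_def cost)
  {
    assume "\<exists>p. awalk u p v \<and> length p \<le> i"
    then obtain p where p: "awalk u p v" "length p \<le> i" by blast
    have "graph_dist G u v \<le> ereal (real (length p))"
      unfolding eq by (rule INF_lower) (use p in simp)
    with p show "graph_dist G u v \<le> ereal (real i)"
      by (meson ereal_less_eq(3) of_nat_le_iff order_trans)
  next
    assume le: "graph_dist G u v \<le> ereal (real i)"
    then have "(INF p\<in>{p. awalk u p v}. ereal (real (length p))) < ereal (real (Suc i))"
      unfolding eq[symmetric] by (rule le_less_trans) simp
    then obtain p where "awalk u p v" "ereal (real (length p)) < ereal (real (Suc i))"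
      by (auto simp: INF_less_iff)
    then show "\<exists>p. awalk u p v \<and> length p \<le> i" by auto
  }
qed

lemma subgroup_graph_auto: "subgroup (graph_auto D) (BijGroup (verts D))"
proof (rule group.subgroupI[OF group_BijGroup])
  show "graph_auto D \<subseteq> carrier (BijGroup (verts D))"
    by (auto simp: graph_auto_def BijGroup_def)
  have "(\<lambda>x\<in>verts D. x) \<in> graph_auto D"
    by (auto simp: graph_auto_def id_Bij)
  then show "graph_auto D \<noteq> {}" by blast
next
  fix f assume f: "f \<in> graph_auto D"
  then have B: "f \<in> Bij (verts D)" by (simp add: graph_auto_def)
  have bij: "bij_betw f (verts D) (verts D)" using B by (simp add: Bij_def)
  let ?h = "\<lambda>x\<in>verts D. inv_into (verts D) f x"
  have "?h u \<rightarrow>\<^bsub>D\<^esub> ?h v \<longleftrightarrow> u \<rightarrow>\<^bsub>D\<^esub> v" if "u \<in> verts D" "v \<in> verts D" for u v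
  proof -
    have "f (?h u) = u" "f (?h v) = v" "?h u \<in> verts D" "?h v \<in> verts D"
      using that bij by (auto simp: bij_betw_inv_into_right bij_betw_def inv_into_into)
    then show ?thesis using f unfolding graph_auto_def by (smt (verit) mem_Collect_eq)
  qed
  then show "inv\<^bsub>BijGroup (verts D)\<^esub> f \<in> graph_auto D"
    using restrict_inv_into_Bij[OF B] by (simp add: inv_BijGroup[OF B] graph_auto_def)
next
  fix f g assume fg: "f \<in> graph_auto D" "g \<in> graph_auto D"
  then have B: "f \<in> Bij (verts D)" "g \<in> Bij (verts D)" by (auto simp: graph_auto_def)
  have "g u \<in> verts D" if "u \<in> verts D" for u
    using Bij_imp_funcset[OF B(2)] that by auto
  then show "f \<otimes>\<^bsub>BijGroup (verts D)\<^esub> g \<in> graph_auto D"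
    using fg B by (auto simp: BijGroup_def compose_Bij graph_auto_def compose_eq)
qed

lemma (in group) p_group_set_mult:
  assumes fin: "finite (carrier G)" and p: "prime p"
    and M: "M \<lhd> G" "p_group p (G\<lparr>carrier := M\<rparr>)"
    and N: "N \<lhd> G" "p_group p (G\<lparr>carrier := N\<rparr>)"
  shows "p_group p (G\<lparr>carrier := M <#> N\<rparr>)"
proof -
  interpret second_isomorphism_grp M G N
    using M N by (simp add: second_isomorphism_grp_def second_isomorphism_grp_axioms_def normal_imp_subgroup)
  let ?MN = "G\<lparr>carrier := M <#> N\<rparr>" and ?N = "G\<lparr>carrier := N\<rparr>"
  interpret MN: group ?MN
    by (simp add: normal_set_mult_subgroup subgroup_imp_group)
  interpret N: group ?N
    using N(2) by (simp add: p_group_def)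
  have sM: "subgroup M ?MN"
    using H_contained_in_set_mult normal_set_mult_subgroup M(1) normal_imp_subgroup subgroup_incl by blast
  have sN: "subgroup (M \<inter> N) ?N"
    using normal_subgrp_intersection_normal normal_imp_subgroup by (metis Int_commute)
  from M(2) obtain m where m: "card M = p ^ m" by (auto simp: p_group_def order_def)
  from N(2) obtain n where n: "card N = p ^ n" by (auto simp: p_group_def order_def)
  have "card (rcosets\<^bsub>?MN\<^esub> M) = card (rcosets\<^bsub>?N\<^esub> (M \<inter> N))"
  proof -
    have "?N Mod (M \<inter> N) \<cong> ?MN Mod M"
      using normal_intersection_quotient_isom unfolding is_iso_def by blast
    from iso_same_card[OF this] show ?thesis by (simp add: FactGroup_def)
  qed
  also have "\<dots> dvd card N"
  proof -
    have "card N = card (rcosets\<^bsub>?N\<^esub> (M \<inter> N)) * card (M \<inter> N)"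
      using N.lagrange[OF sN] by (simp add: order_def)
    then show ?thesis by (rule dvdI)
  qed
  finally have "card (rcosets\<^bsub>?MN\<^esub> M) dvd p ^ n" by (simp add: n)
  then obtain k where k: "card (rcosets\<^bsub>?MN\<^esub> M) = p ^ k"
    using divides_primepow_nat[OF p] by auto
  have "order ?MN = p ^ (k + m)"
    using MN.lagrange[OF sM] by (simp add: m k power_add)
  then show ?thesis
    using MN.is_group by (auto simp: p_group_def)
qed

lemma (in group) normal_set_mult_normal:
  assumes "M \<lhd> G" "N \<lhd> G"
  shows "M <#> N \<lhd> G"
proof -
  interpret second_isomorphism_grp M G N
    using assms by (simp add: second_isomorphism_grp_def second_isomorphism_grp_axioms_def normal_imp_subgroup)
  show ?thesis
  proof (rule normal_invI[OF normal_set_mult_subgroup])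
    fix g h assume g: "g \<in> carrier G" and "h \<in> M <#> N"
    then obtain a b where ab: "a \<in> M" "b \<in> N" "h = a \<otimes> b"
      by (auto simp: set_mult_def)
    have c: "a \<in> carrier G" "b \<in> carrier G"
      using ab assms by (auto dest: normal_imp_subgroup subgroup.subset)
    have "g \<otimes> a \<otimes> inv g \<in> M" "g \<otimes> b \<otimes> inv g \<in> N"
      using ab g assms by (auto simp: normal_inv_iff)
    moreover have "g \<otimes> h \<otimes> inv g = (g \<otimes> a \<otimes> inv g) \<otimes> (g \<otimes> b \<otimes> inv g)"
      using g c by (simp add: ab(3) m_assoc inv_solve_left)
    ultimately show "g \<otimes> h \<otimes> inv g \<in> M <#> N"
      unfolding set_mult_def by blast
  qed
qed

theorem (in group) p_core_greatest:
  assumes fin: "finite (carrier G)" and q: "prime q"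
  shows "p_core q G \<lhd> G" and "p_group q (G\<lparr>carrier := p_core q G\<rparr>)"
    and "\<And>N. N \<lhd> G \<Longrightarrow> p_group q (G\<lparr>carrier := N\<rparr>) \<Longrightarrow> N \<subseteq> p_core q G"
proof -
  define P where "P N \<longleftrightarrow> N \<lhd> G \<and> p_group q (G\<lparr>carrier := N\<rparr>)" for N
  have sub: "N \<subseteq> carrier G" if "P N" for N
    using that by (auto simp: P_def dest: normal_imp_subgroup subgroup.subset)
  have "order (G\<lparr>carrier := {\<one>}\<rparr>) = q ^ 0"
    by (simp add: order_def)
  then have "P {\<one>}"
    using one_is_normal subgroup_imp_group[OF triv_subgroup] unfolding P_def p_group_def by blast
  moreover have "card M < Suc (card (carrier G))" if "P M" for M
    using card_mono[OF fin sub[OF that]] by simp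
  ultimately have "\<exists>N. P N \<and> (\<forall>M. P M \<longrightarrow> card M \<le> card N)"
    by (intro ex_has_greatest_nat) auto
  then obtain N where N: "P N" and max: "\<And>M. P M \<Longrightarrow> card M \<le> card N"
    by blast
  have le: "M \<subseteq> N" if M: "P M" for M
  proof -
    interpret second_isomorphism_grp M G N
      using M N by (simp add: P_def second_isomorphism_grp_def second_isomorphism_grp_axioms_def normal_imp_subgroup)
    have MN: "P (M <#> N)"
      using M N p_group_set_mult[OF fin q] normal_set_mult_normal by (auto simp: P_def)
    have "N = M <#> N"
      using max[OF MN] S_contained_in_set_mult sub[OF MN] fin
      by (meson card_seteq finite_subset)
    then show ?thesis using H_contained_in_set_mult by simp
  qed
  have "p_core q G = N"
    unfolding p_core_def P_def[symmetric] using N le by (rule Greatest_equality)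
  then show "p_core q G \<lhd> G" "p_group q (G\<lparr>carrier := p_core q G\<rparr>)"
    "\<And>N. N \<lhd> G \<Longrightarrow> p_group q (G\<lparr>carrier := N\<rparr>) \<Longrightarrow> N \<subseteq> p_core q G"
    using N le by (auto simp: P_def)
qed

lemma transitive_perm_iff:
  assumes "subgroup X (BijGroup S)"
  shows "transitive_perm X S \<longleftrightarrow> (\<forall>a\<in>S. \<forall>b\<in>S. \<exists>g\<in>X. g a = b)"
proof -
  have "group_hom (perm_group S X) (BijGroup S) (\<lambda>g. g)"
    using assms group.subgroup_imp_group[OF group_BijGroup] group_BijGroup subgroup.subset
    by (fastforce simp: group_hom_def group_hom_axioms_def hom_def)
  then show ?thesis
    by (auto simp: transitive_perm_def transitive_action_def transitive_action_axioms_def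
        group_action_def)
qed

end

theory Submission
  imports Defs "HOL-Algebra.Sylow" "HOL-Algebra.Multiplicative_Group"
begin

text \<open>
  Write \<open>A = G\<^sub>x\<close>, \<open>B = G\<^sub>y\<close>, \<open>H = A \<inter> B\<close>, and let \<open>K\<close>, \<open>L\<close> be the kernels of \<open>A\<close>, \<open>B\<close> on the
  neighbours of \<open>x\<close>, \<open>y\<close>. Only three facts about the graph matter: no nontrivial subgroup of \<open>H\<close> is
  normal in both \<open>A\<close> and \<open>B\<close>; a subgroup \<open>X\<close> of \<open>A\<close> is transitive on the neighbours of \<open>x\<close> iff \<open>A = X H\<close>;
  and the kernel of \<open>A\<close> on the ball of radius 2 is the largest normal subgroup \<open>U\<close> of \<open>A\<close> inside
  \<open>K \<inter> L\<close>. Let \<open>W\<close> be the corresponding subgroup of \<open>B\<close>.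

  If \<open>A = C\<^sub>A(K) H\<close>, then subgroups of \<open>K\<close> normal in \<open>H\<close> are normal in \<open>A\<close>, so \<open>K \<inter> L = U\<close> and \<open>W = 1\<close>.
  If centralisers are semiregular at both ends, then every component of \<open>H\<close> lies in \<open>K\<close> and in \<open>L\<close>
  (a component lies in a normal subgroup or centralises it), so the components of \<open>H\<close> generate a
  normal subgroup of both \<open>A\<close> and \<open>B\<close>, and there are none.

  For a prime \<open>p\<close> with \<open>O\<^sub>p(H) \<noteq> 1\<close>, condition (ii) must be met by transitivity at \<open>x\<close> or at \<open>y\<close>, since
  \<open>O\<^sub>p(H) \<le> K\<close> forces \<open>O\<^sub>p(H) = O\<^sub>p(K)\<close>, which is normal in \<open>A\<close>. Transitivity at \<open>x\<close> makes \<open>O\<^sup>p(S)\<close> normal in \<open>A\<close>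
  for each \<open>S \<le> K\<close> normal in \<open>H\<close>, because \<open>O\<^sub>p\<close> of a group normalises \<open>O\<^sup>p\<close> of each subnormal
  subgroup. With \<open>S = K \<inter> L\<close> and \<open>S = W\<close> this gives the theorem, comparing two such primes if there
  are two.
\<close>

section \<open>Finite groups\<close>

lemma prime_power_if_unique_prime_divisor:
  assumes "prime (p::nat)" "n > 0" "\<And>q. prime q \<Longrightarrow> q dvd n \<Longrightarrow> q = p"
  shows "\<exists>k. n = p ^ k"
proof -
  have "n = p ^ multiplicity p n * (n div p ^ multiplicity p n)"
    by (simp add: multiplicity_dvd)
  moreover have "n div p ^ multiplicity p n = 1"
  proof (rule ccontr)
    assume "n div p ^ multiplicity p n \<noteq> 1"
    then obtain q where q: "prime q" "q dvd n div p ^ multiplicity p n"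
      using prime_factor_nat by blast
    then have "q dvd n"
      using multiplicity_dvd div_dvd_iff_mult by (metis calculation dvd_mult)
    then have "p dvd n div p ^ multiplicity p n"
      using assms(3) q by blast
    then show False
      using assms(2) prime_gt_1_nat[OF assms(1)] multiplicity_decompose[of n p] by auto
  qed
  ultimately show ?thesis by (metis mult.right_neutral)
qed

section \<open>Normality, powers and coprime exponents inside subgroups\<close>

context group
begin

text \<open>Together with \<open>word_simps\<close>, which associates to the right, these
  cancellations settle the group-word identities below.\<close>

lemma cancel_left [simp]:
  assumes "x \<in> carrier G" "y \<in> carrier G"
  shows "inv x \<otimes> (x \<otimes> y) = y" "x \<otimes> (inv x \<otimes> y) = y"
  using assms by (simp_all flip: m_assoc)

lemmas word_simps = m_assoc inv_mult_group

text \<open>Removes the product and inverse of the restricted group, so that nested subgroups can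
  all be compared inside one ambient group.\<close>

lemma normal_in_iff:
  assumes "subgroup H G"
  shows "N \<lhd> G\<lparr>carrier := H\<rparr> \<longleftrightarrow>
    subgroup N G \<and> N \<subseteq> H \<and> (\<forall>h\<in>H. \<forall>n\<in>N. h \<otimes> n \<otimes> inv h \<in> N)"
proof -
  interpret H: group "G\<lparr>carrier := H\<rparr>"
    using assms by (rule subgroup_imp_group)
  have sub: "subgroup N (G\<lparr>carrier := H\<rparr>) \<longleftrightarrow> subgroup N G \<and> N \<subseteq> H"
    using incl_subgroup[OF assms] subgroup_incl[OF _ assms] subgroup.subset[of N "G\<lparr>carrier := H\<rparr>"] by auto
  show ?thesis
    by (simp add: H.normal_inv_iff sub m_inv_consistent[OF assms] cong: conj_cong)
qed

lemma pow_consistent [simp]: "x [^]\<^bsub>G\<lparr>carrier := H\<rparr>\<^esub> (n::nat) = x [^] n"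
  using nat_pow_consistent by simp

lemma subgroup_pow_closed: "subgroup H G \<Longrightarrow> x \<in> H \<Longrightarrow> x [^] (n::nat) \<in> H"
  by (induction n) (auto simp: subgroup.one_closed subgroup.m_closed)

lemma p_group_iff:
  assumes "subgroup N G"
  shows "p_group p (G\<lparr>carrier := N\<rparr>) \<longleftrightarrow> (\<exists>n. card N = p ^ n)"
  using subgroup_imp_group[OF assms] by (simp add: p_group_def order_def)

lemma pow_card_subgroup:
  assumes "subgroup N G" "x \<in> N"
  shows "x [^] card N = \<one>"
  using group.pow_order_eq_1[OF subgroup_imp_group[OF assms(1)], of x] assms by (simp add: order_def)

lemma p_group_elem:
  assumes "subgroup N G" "p_group p (G\<lparr>carrier := N\<rparr>)" "x \<in> N"
  obtains k where "x [^] (p ^ k) = \<one>"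
  using assms pow_card_subgroup p_group_iff by metis

lemma cauchy:
  assumes "subgroup N G" "finite N" "prime q" "q dvd card N"
  obtains Q where "subgroup Q G" "Q \<subseteq> N" "card Q = q"
proof -
  from assms(4) obtain m where "card N = q ^ 1 * m" by auto
  then have "\<exists>Q. subgroup Q (G\<lparr>carrier := N\<rparr>) \<and> card Q = q ^ 1"
    using assms subgroup_imp_group by (intro sylow_thm) (auto simp: order_def)
  then show thesis
    using that incl_subgroup[OF assms(1)] subgroup.subset by fastforce
qed

text \<open>Bezout writes \<open>v\<close> as the quotient of a power of one of the two given
  elements by a power of the other.\<close>

lemma coprime_pow_mem:
  assumes "subgroup H G" "v \<in> carrier G" "v [^] (n::nat) \<in> H" "v [^] (m::nat) \<in> H" "coprime m n"
  shows "v \<in> H"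
proof -
  have *: "v \<in> H" if "v [^] (a::nat) \<in> H" "v [^] (b::nat) \<in> H" "a * x = b * y + 1" for a b x y
  proof -
    have "v [^] (a * x) = v [^] (b * y) \<otimes> v"
      using that assms(2) by simp
    then have "v = inv (v [^] (b * y)) \<otimes> v [^] (a * x)"
      using assms(2) by simp
    moreover have "v [^] (a * x) \<in> H" "v [^] (b * y) \<in> H"
      using that assms(1,2) subgroup_pow_closed by (metis nat_pow_pow)+
    ultimately show ?thesis
      using assms(1) by (metis subgroup.m_closed subgroup.m_inv_closed)
  qed
  show ?thesis
  \<comment> \<open>\<open>bezout_nat\<close> wants a nonzero argument; for \<open>n = 0\<close>
    coprimality forces \<open>m = 1\<close>.\<close>
  proof (cases "n = 0")
    case True
    then show ?thesis using assms by simp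
  next
    case False
    then obtain x y where "n * x = m * y + 1"
      using bezout_nat[of n m] assms(5) by (auto simp: coprime_commute)
    then show ?thesis using * assms(3,4) by blast
  qed
qed

lemma conj_pow:
  assumes "a \<in> carrier G" "x \<in> carrier G"
  shows "(a \<otimes> x \<otimes> inv a) [^] (n::nat) = a \<otimes> x [^] n \<otimes> inv a"
  using assms by (induction n) (simp_all add: word_simps)

text \<open>Modulo \<open>S\<close> the factor \<open>g\<close> disappears, so \<open>g v\<close>
  and \<open>v\<close> have the same powers there.\<close>

lemma mult_pow_normal:
  assumes X: "subgroup X G" and S: "S \<lhd> G\<lparr>carrier := X\<rparr>" and "g \<in> S" "v \<in> X"
  shows "(g \<otimes> v) [^] (n::nat) \<otimes> inv (v [^] n) \<in> S"
proof (induction n)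
  case 0
  then show ?case
    using normal_in_iff[THEN iffD1, OF X S] by (simp add: subgroup.one_closed)
next
  case (Suc n)
  note S = normal_in_iff[THEN iffD1, OF X S]
  have [simp]: "g \<in> carrier G" "v \<in> carrier G"
    using assms(3,4) S X subgroup.mem_carrier by fast+
  have "v [^] n \<otimes> g \<otimes> inv (v [^] n) \<in> S"
    using S assms(3,4) subgroup_pow_closed[OF X] by blast
  then have "((g \<otimes> v) [^] n \<otimes> inv (v [^] n)) \<otimes> (v [^] n \<otimes> g \<otimes> inv (v [^] n)) \<in> S"
    using S Suc subgroup.m_closed by fast
  then show ?case
    by (simp add: word_simps)
qed

text \<open>The heart of the fact that \<open>O\<^sub>p\<close> normalises \<open>O\<^sup>p\<close>
  of a subnormal subgroup. The commutator \<open>v = g^-1 (u g u^-1)\<close> lies in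
  \<open>K\<close> and in \<open>P\<close>, so a \<open>p\<close>-power kills it. As
  \<open>g v\<close> is conjugate to \<open>g\<close>, its \<open>n\<close>-th power is trivial,
  which puts \<open>v^n\<close> into \<open>S\<close>. Since \<open>n\<close> is prime to
  \<open>p\<close>, \<open>v\<close> itself lies in \<open>S\<close>.\<close>

lemma coprime_conj_mem:
  assumes H: "subgroup H G" and K: "K \<lhd> G\<lparr>carrier := H\<rparr>" and S: "S \<lhd> G\<lparr>carrier := K\<rparr>"
    and P: "P \<lhd> G\<lparr>carrier := H\<rparr>" "p_group p (G\<lparr>carrier := P\<rparr>)"
    and g: "g \<in> S" "g [^] (n::nat) = \<one>" "coprime n p" and u: "u \<in> P"
  shows "u \<otimes> g \<otimes> inv u \<in> S"
proof -
  note K = normal_in_iff[THEN iffD1, OF H K]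
  note P' = normal_in_iff[THEN iffD1, OF H P(1)]
  note S' = normal_in_iff[THEN iffD1, OF conjunct1[OF K] S]
  have [simp]: "g \<in> carrier G" "u \<in> carrier G"
    using g u S' P' by (meson subgroup.mem_carrier)+
  define v where "v = inv g \<otimes> (u \<otimes> g \<otimes> inv u)"
  have gK: "g \<in> K" "inv g \<in> K" and uH: "u \<in> H"
    using g u S' K P' by (auto simp: subgroup.m_inv_closed)
  have vK: "v \<in> K"
    unfolding v_def using K gK uH subgroup.m_closed by fast
  have "inv g \<otimes> u \<otimes> inv (inv g) \<in> P"
    using P' K gK u by blast
  then have "(inv g \<otimes> u \<otimes> inv (inv g)) \<otimes> inv u \<in> P"
    using P' u by (meson subgroup.m_closed subgroup.m_inv_closed)
  then have "v \<in> P"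
    by (simp add: v_def word_simps)
  then obtain k where k: "v [^] (p ^ k) = \<one>"
    using P P' p_group_elem by blast
  have gv: "g \<otimes> v = u \<otimes> g \<otimes> inv u"
    by (simp add: v_def word_simps)
  have [simp]: "v \<in> carrier G"
    by (simp add: v_def)
  have "(g \<otimes> v) [^] n = \<one>"
    using g by (simp add: gv conj_pow)
  then have "inv (v [^] n) \<in> S"
    using mult_pow_normal[OF conjunct1[OF K] S g(1) vK, of n] by simp
  then have "v [^] n \<in> S"
    using S' by (metis \<open>v \<in> carrier G\<close> inv_inv nat_pow_closed subgroup.m_inv_closed)
  moreover have "v [^] (p ^ k) \<in> S"
    using k S' subgroup.one_closed by metis
  ultimately have "v \<in> S"
    using S' g(3) by (intro coprime_pow_mem[of S v n "p ^ k"]) (auto simp: coprime_commute)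
  then show ?thesis
    using g(1) S' subgroup.m_closed unfolding gv[symmetric] by fast
qed

lemma conj_image_subgroup:
  assumes "subgroup N G" and [simp]: "a \<in> carrier G"
  shows "subgroup ((\<lambda>n. a \<otimes> n \<otimes> inv a) ` N) G"
proof (rule subgroupI)
  interpret N: subgroup N G by fact
  show "(\<lambda>n. a \<otimes> n \<otimes> inv a) ` N \<subseteq> carrier G" "(\<lambda>n. a \<otimes> n \<otimes> inv a) ` N \<noteq> {}"
    using N.subset N.one_closed by (auto, blast)
  fix x assume "x \<in> (\<lambda>n. a \<otimes> n \<otimes> inv a) ` N"
  then obtain n where n: "n \<in> N" "x = a \<otimes> n \<otimes> inv a" by auto
  then have "inv x = a \<otimes> inv n \<otimes> inv a" by (simp add: word_simps)
  then show "inv x \<in> (\<lambda>n. a \<otimes> n \<otimes> inv a) ` N" using n by blast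
  fix y assume "y \<in> (\<lambda>n. a \<otimes> n \<otimes> inv a) ` N"
  then obtain m where m: "m \<in> N" "y = a \<otimes> m \<otimes> inv a" by auto
  then have "x \<otimes> y = a \<otimes> (n \<otimes> m) \<otimes> inv a" using n by (simp add: word_simps)
  then show "x \<otimes> y \<in> (\<lambda>n. a \<otimes> n \<otimes> inv a) ` N" using n m by blast
qed

lemma conj_image_card:
  assumes "N \<subseteq> carrier G" "a \<in> carrier G"
  shows "card ((\<lambda>n. a \<otimes> n \<otimes> inv a) ` N) = card N"
  using assms by (intro card_image inj_onI) (auto simp: subset_iff)

section \<open>The subgroups \<open>O\<^sub>p\<close>\<close>

abbreviation Op :: "nat \<Rightarrow> 'a set \<Rightarrow> 'a set" where
  "Op p H \<equiv> p_core p (G\<lparr>carrier := H\<rparr>)"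

lemma p_core_in:
  assumes "finite (carrier G)" "prime p" "subgroup H G"
  shows "Op p H \<lhd> G\<lparr>carrier := H\<rparr>" "p_group p (G\<lparr>carrier := Op p H\<rparr>)"
    "\<And>N. N \<lhd> G\<lparr>carrier := H\<rparr> \<Longrightarrow> p_group p (G\<lparr>carrier := N\<rparr>) \<Longrightarrow> N \<subseteq> Op p H"
proof -
  have "finite (carrier (G\<lparr>carrier := H\<rparr>))"
    using finite_subset[OF subgroup.subset[OF assms(3)] assms(1)] by simp
  from group.p_core_greatest[OF subgroup_imp_group[OF assms(3)] this assms(2)]
  show "Op p H \<lhd> G\<lparr>carrier := H\<rparr>" "p_group p (G\<lparr>carrier := Op p H\<rparr>)"
    "\<And>N. N \<lhd> G\<lparr>carrier := H\<rparr> \<Longrightarrow> p_group p (G\<lparr>carrier := N\<rparr>) \<Longrightarrow> N \<subseteq> Op p H"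
    by simp_all
qed

lemma p_core_in_subgroup:
  assumes "finite (carrier G)" "prime p" "subgroup H G"
  shows "subgroup (Op p H) G" "Op p H \<subseteq> H"
    "\<And>h n. h \<in> H \<Longrightarrow> n \<in> Op p H \<Longrightarrow> h \<otimes> n \<otimes> inv h \<in> Op p H"
  using normal_in_iff[THEN iffD1, OF assms(3) p_core_in(1)[OF assms]] by blast+

text \<open>\<open>KL\<close> and \<open>LK\<close> make conjugation by \<open>a\<close> an
  isomorphism from \<open>K\<close> onto \<open>L\<close>. The image of \<open>Op p K\<close> is
  normal in \<open>L\<close> and has the same order, so maximality of \<open>Op p L\<close>
  applies.\<close>

lemma p_core_conj:
  assumes fin: "finite (carrier G)" and p: "prime p" and K: "subgroup K G" and L: "subgroup L G"
    and [simp]: "a \<in> carrier G"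
    and KL: "\<And>k. k \<in> K \<Longrightarrow> a \<otimes> k \<otimes> inv a \<in> L" and LK: "\<And>k. k \<in> L \<Longrightarrow> inv a \<otimes> k \<otimes> a \<in> K"
    and n: "n \<in> Op p K"
  shows "a \<otimes> n \<otimes> inv a \<in> Op p L"
proof -
  note O = p_core_in_subgroup[OF fin p K]
  let ?N = "(\<lambda>n. a \<otimes> n \<otimes> inv a) ` Op p K"
  have sN: "subgroup ?N G"
    using O(1) by (rule conj_image_subgroup) simp
  have "k \<otimes> (a \<otimes> m \<otimes> inv a) \<otimes> inv k \<in> ?N" if k: "k \<in> L" and m: "m \<in> Op p K" for k m
  proof -
    have c: "k \<in> carrier G" "m \<in> carrier G"
      using k m L O by (meson subgroup.mem_carrier)+
    from O(3)[OF LK[OF k] m]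
    have "a \<otimes> ((inv a \<otimes> k \<otimes> a) \<otimes> m \<otimes> inv (inv a \<otimes> k \<otimes> a)) \<otimes> inv a \<in> ?N"
      by blast
    then show ?thesis
      using c by (simp add: word_simps)
  qed
  moreover have "?N \<subseteq> L"
    using O(2) KL by blast
  ultimately have "?N \<lhd> G\<lparr>carrier := L\<rparr>"
    using sN by (auto simp: normal_in_iff[OF L])
  moreover have "p_group p (G\<lparr>carrier := ?N\<rparr>)"
    using p_core_in(2)[OF fin p K] conj_image_card[OF subgroup.subset[OF O(1)]]
    by (simp add: p_group_iff[OF sN] p_group_iff[OF O(1)])
  ultimately show ?thesis
    using p_core_in(3)[OF fin p L] n by blast
qed

text \<open>Elements of \<open>A\<close> induce automorphisms of \<open>K\<close>, and these
  preserve its largest normal \<open>p\<close>-subgroup.\<close>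

lemma p_core_normal:
  assumes fin: "finite (carrier G)" and p: "prime p" and A: "subgroup A G" and K: "K \<lhd> G\<lparr>carrier := A\<rparr>"
  shows "Op p K \<lhd> G\<lparr>carrier := A\<rparr>"
proof -
  note K = normal_in_iff[THEN iffD1, OF A K]
  then have sK: "subgroup K G" by blast
  note O = p_core_in_subgroup[OF fin p sK]
  have "a \<otimes> n \<otimes> inv a \<in> Op p K" if a: "a \<in> A" and n: "n \<in> Op p K" for a n
  proof (rule p_core_conj[OF fin p sK sK _ _ _ n])
    show a': "a \<in> carrier G" using a A by (rule subgroup.mem_carrier[rotated])
    show "a \<otimes> k \<otimes> inv a \<in> K" if "k \<in> K" for k
      using K a that by blast
    have "inv a \<in> A" using A a by (rule subgroup.m_inv_closed)
    then show "inv a \<otimes> k \<otimes> a \<in> K" if "k \<in> K" for k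
      using K that a' by (metis inv_inv)
  qed
  then show ?thesis
    using O K by (auto simp: normal_in_iff[OF A])
qed

lemma p_core_mono:
  assumes "finite (carrier G)" "prime p" "subgroup A G" "K \<lhd> G\<lparr>carrier := A\<rparr>"
  shows "Op p K \<subseteq> Op p A"
proof -
  have "subgroup K G"
    using assms normal_in_iff by blast
  then show ?thesis
    using p_core_in[OF assms(1,2)] p_core_normal[OF assms] assms by blast
qed

section \<open>Generated subgroups and \<open>O\<^sup>p\<close>\<close>

lemma generate_conj_closed:
  assumes "T \<subseteq> carrier G" and [simp]: "a \<in> carrier G"
    and T: "\<And>t. t \<in> T \<Longrightarrow> a \<otimes> t \<otimes> inv a \<in> generate G T"
    and x: "x \<in> generate G T"
  shows "a \<otimes> x \<otimes> inv a \<in> generate G T"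
proof -
  interpret N: subgroup "generate G T" G
    using assms(1) by (rule generate_is_subgroup)
  show ?thesis
    using x
  proof (induction rule: generate.induct)
    case one
    then show ?case by simp
  next
    case (incl h)
    then show ?case by (rule T)
  next
    case (inv h)
    then have "h \<in> carrier G" using assms(1) by blast
    then have "a \<otimes> inv h \<otimes> inv a = inv (a \<otimes> h \<otimes> inv a)" by (simp add: word_simps)
    then show ?case using T[OF inv] by simp
  next
    case (eng h k)
    then have "a \<otimes> (h \<otimes> k) \<otimes> inv a = (a \<otimes> h \<otimes> inv a) \<otimes> (a \<otimes> k \<otimes> inv a)"
      by (simp add: word_simps)
    then show ?case using eng by simp
  qed
qed

text \<open>For finite \<open>S\<close> this is \<open>O\<^sup>p(S)\<close>.\<close>

definition p_residual :: "nat \<Rightarrow> 'a set \<Rightarrow> 'a set" where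
  "p_residual p S = generate G {g \<in> S. \<exists>n::nat. coprime n p \<and> g [^] n = \<one>}"

lemma p_residual_subgroup:
  assumes "subgroup S G"
  shows "subgroup (p_residual p S) G" "p_residual p S \<subseteq> S"
  unfolding p_residual_def
  using subgroup.subset[OF assms] generate_subgroup_incl[OF _ assms]
  by (auto intro!: generate_is_subgroup)

text \<open>Only the elements of \<open>S\<close> with exponent prime to \<open>p\<close> have to
  stay in \<open>S\<close> under \<open>a\<close>. This is what \<open>coprime_conj_mem\<close>
  provides; it does not say that \<open>a\<close> normalises \<open>S\<close>.\<close>

lemma p_residual_conj:
  assumes S: "subgroup S G" and [simp]: "a \<in> carrier G"
    and a: "\<And>g n. g \<in> S \<Longrightarrow> coprime (n::nat) p \<Longrightarrow> g [^] n = \<one> \<Longrightarrow> a \<otimes> g \<otimes> inv a \<in> S"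
    and x: "x \<in> p_residual p S"
  shows "a \<otimes> x \<otimes> inv a \<in> p_residual p S"
proof -
  have "a \<otimes> t \<otimes> inv a \<in> S \<and> (\<exists>n::nat. coprime n p \<and> (a \<otimes> t \<otimes> inv a) [^] n = \<one>)"
    if "t \<in> S" "coprime n p" "t [^] n = \<one>" for t and n::nat
  proof -
    have "t \<in> carrier G" using S that(1) by (rule subgroup.mem_carrier)
    then have "(a \<otimes> t \<otimes> inv a) [^] n = \<one>" using that by (simp add: conj_pow)
    then show ?thesis using a that by blast
  qed
  then have "a \<otimes> t \<otimes> inv a \<in> p_residual p S"
    if "t \<in> {g \<in> S. \<exists>n::nat. coprime n p \<and> g [^] n = \<one>}" for t
    unfolding p_residual_def using that by (intro generate.incl) blast
  moreover have "{g \<in> S. \<exists>n::nat. coprime n p \<and> g [^] n = \<one>} \<subseteq> carrier G"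
    using subgroup.subset[OF S] by blast
  ultimately show ?thesis
    using generate_conj_closed[OF _ assms(2)] x unfolding p_residual_def by blast
qed

lemma p_residual_normal:
  assumes "subgroup A G" "S \<lhd> G\<lparr>carrier := A\<rparr>"
  shows "p_residual p S \<lhd> G\<lparr>carrier := A\<rparr>"
proof -
  note S = normal_in_iff[THEN iffD1, OF assms]
  have "a \<otimes> x \<otimes> inv a \<in> p_residual p S" if "a \<in> A" "x \<in> p_residual p S" for a x
    by (rule p_residual_conj) (use S that subgroup.mem_carrier[OF assms(1)] in auto)
  then show ?thesis
    using S p_residual_subgroup[of S p] by (auto simp: normal_in_iff[OF assms(1)])
qed

text \<open>A prime \<open>q\<close> other than \<open>p\<close> dividing the order would give, by
  Cauchy, a subgroup of order \<open>q\<close>, and this lies in the residual.\<close>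

lemma p_group_if_p_residual_trivial:
  assumes S: "subgroup S G" "finite S" and p: "prime p" and R: "p_residual p S = {\<one>}"
  shows "p_group p (G\<lparr>carrier := S\<rparr>)"
proof -
  have "q = p" if q: "prime q" "q dvd card S" for q
  proof (rule ccontr)
    assume "q \<noteq> p"
    then have co: "coprime q p" using p q primes_coprime by blast
    obtain Q where Q: "subgroup Q G" "Q \<subseteq> S" "card Q = q"
      using cauchy S q by blast
    have "x = \<one>" if "x \<in> Q" for x
    proof -
      have "x [^] q = \<one>" using pow_card_subgroup[OF Q(1) that] Q(3) by simp
      then have "x \<in> p_residual p S"
        unfolding p_residual_def using co Q(2) that by (blast intro: generate.incl)
      then show ?thesis using R by simp
    qed
    then have "Q \<subseteq> {\<one>}" by blast
    then have "card Q \<le> 1" using card_mono[of "{\<one>}" Q] by simp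
    then show False using Q(3) prime_gt_1_nat[OF q(1)] by simp
  qed
  moreover have "card S > 0" using S subgroup.one_closed[OF S(1)] by (auto simp: card_gt_0_iff)
  ultimately show ?thesis
    unfolding p_group_iff[OF S(1)] using prime_power_if_unique_prime_divisor[OF p] by blast
qed

text \<open>Let the order be \<open>p^a m\<close> with \<open>m\<close> prime to \<open>p\<close>.
  Then \<open>g^(p^a)\<close> is killed by \<open>m\<close> and lies in the
  \<open>p\<close>-residual, while \<open>g^m\<close> is killed by \<open>p^a\<close> and lies in
  the \<open>q\<close>-residual. The two exponents are coprime, so \<open>g\<close> can be
  recovered.\<close>

lemma p_residuals_generate:
  assumes S: "subgroup S G" "finite S" and pq: "prime p" "prime q" "p \<noteq> q"
    and T: "subgroup T G" "p_residual p S \<subseteq> T" "p_residual q S \<subseteq> T"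
  shows "S \<subseteq> T"
proof
  fix g assume g: "g \<in> S"
  then have [simp]: "g \<in> carrier G" using S subgroup.mem_carrier by fast
  have pos: "card S \<noteq> 0" using S subgroup.one_closed[OF S(1)] by auto
  obtain m where m: "card S = p ^ multiplicity p (card S) * m" "\<not> p dvd m"
    using multiplicity_decompose'[OF pos, of p] prime_gt_1_nat[OF pq(1)] by auto
  define a where "a = multiplicity p (card S)"
  have "g [^] (p ^ a * m) = \<one>"
    using pow_card_subgroup[OF S(1) g] m by (simp add: a_def)
  then have 1: "(g [^] (p ^ a)) [^] m = \<one>" "(g [^] m) [^] (p ^ a) = \<one>"
    by (simp_all add: nat_pow_pow mult.commute)
  have mp: "coprime m p"
    using m(2) pq(1) prime_imp_coprime[of p m] by (simp add: coprime_commute)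
  have aq: "coprime (p ^ a) q"
    using primes_coprime[OF pq] by simp
  have "g [^] (p ^ a) \<in> p_residual p S"
    unfolding p_residual_def using 1 mp subgroup_pow_closed[OF S(1) g] by (intro generate.incl) blast
  moreover have "g [^] m \<in> p_residual q S"
    unfolding p_residual_def using 1 aq subgroup_pow_closed[OF S(1) g] by (intro generate.incl) blast
  ultimately show "g \<in> T"
    using mp T coprime_pow_mem[OF T(1), of g m "p ^ a"] by (auto simp: coprime_commute)
qed

end

section \<open>Components\<close>

context group
begin

lemma subnormal_subgroup: "subnormal G K \<Longrightarrow> subgroup K G"
proof (induction rule: subnormal.induct)
  case whole
  then show ?case by (rule subgroup_self)
next
  case (step K H)
  then show ?case using normal_in_iff by blast
qed

text \<open>\<open>p_core_mono\<close> is applied at each link of the subnormal chain.\<close>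

lemma subnormal_p_core:
  assumes "finite (carrier G)" "prime p" "subnormal G K"
  shows "Op p K \<subseteq> Op p (carrier G)"
  using assms(3)
proof (induction rule: subnormal.induct)
  case whole
  then show ?case by simp
next
  case (step K H)
  then show ?case
    using p_core_mono[OF assms(1,2) subnormal_subgroup[OF step(1)] step(2)] by blast
qed

lemma subgroup_normal_self: "subgroup H G \<Longrightarrow> H \<lhd> G\<lparr>carrier := H\<rparr>"
  using group.normal_self[OF subgroup_imp_group] by fastforce

text \<open>A \<open>p\<close>-group lies in its own \<open>O\<^sub>p\<close>, and inclusion of the
  \<open>O\<^sub>p\<close> passes up the chain.\<close>

lemma subnormal_p_subgroup_le_p_core:
  assumes "finite (carrier G)" "prime p" "subnormal G P" "p_group p (G\<lparr>carrier := P\<rparr>)"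
  shows "P \<subseteq> Op p (carrier G)"
  using p_core_in(3)[OF assms(1,2) subnormal_subgroup[OF assms(3)] subgroup_normal_self assms(4)]
    subnormal_p_core[OF assms(1-3)] subnormal_subgroup[OF assms(3)] by blast

text \<open>The three subgroups lemma: \<open>K\<close> and \<open>nKn\<^sup>-\<^sup>1\<close> centralise \<open>N \<inter> H\<close>, which contains \<open>[n, K]\<close>. So the commutators
  \<open>[n, k]\<close> commute with \<open>K\<close> and with each other, and \<open>n\<close> centralises \<open>[K, K] = K\<close>.\<close>

lemma normal_or_commutes_step:
  assumes L: "subgroup L G" and H: "H \<lhd> G\<lparr>carrier := L\<rparr>" and N: "N \<lhd> G\<lparr>carrier := L\<rparr>"
    and K: "subgroup K G" "K \<subseteq> H" "derived G K = K"
    and comm: "\<And>k n. k \<in> K \<Longrightarrow> n \<in> N \<inter> H \<Longrightarrow> k \<otimes> n = n \<otimes> k"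
    and "k \<in> K" "n \<in> N"
  shows "k \<otimes> n = n \<otimes> k"
proof -
  note H = normal_in_iff[THEN iffD1, OF L H]
  note N = normal_in_iff[THEN iffD1, OF L N]
  interpret L: subgroup L G by fact
  interpret H: subgroup H G using H by blast
  interpret N: subgroup N G using N by blast
  interpret K: subgroup K G by fact
  have [simp]: "n \<in> carrier G" using assms by simp
  have nL: "n \<in> L" "inv n \<in> L" using N assms by auto
  define c where "c x = n \<otimes> x \<otimes> inv n \<otimes> inv x" for x
  have cNH: "c x \<in> N \<inter> H" if "x \<in> K" for x
  proof -
    have x: "x \<in> H" "x \<in> L" "x \<in> carrier G" using that K H by auto
    have "x \<otimes> inv n \<otimes> inv x \<in> N" using x N \<open>n \<in> N\<close> by auto
    then have "n \<otimes> (x \<otimes> inv n \<otimes> inv x) \<in> N" using \<open>n \<in> N\<close> by blast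
    moreover have "(n \<otimes> x \<otimes> inv n) \<otimes> inv x \<in> H" using x H nL by auto
    ultimately show ?thesis using x by (simp add: c_def word_simps)
  qed
  have comm': "(n \<otimes> x \<otimes> inv n) \<otimes> m = m \<otimes> (n \<otimes> x \<otimes> inv n)" if x: "x \<in> K" and m: "m \<in> N \<inter> H" for x m
  proof -
    have [simp]: "x \<in> carrier G" "m \<in> carrier G" using x m by auto
    have "inv n \<otimes> m \<otimes> inv (inv n) \<in> N \<inter> H"
      using m nL(2) bspec[OF bspec[OF conjunct2[OF conjunct2[OF N]] nL(2)], of m]
        bspec[OF bspec[OF conjunct2[OF conjunct2[OF H]] nL(2)], of m] by auto
    then have "x \<otimes> (inv n \<otimes> m \<otimes> n) = (inv n \<otimes> m \<otimes> n) \<otimes> x"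
      using comm x by simp
    then have "n \<otimes> (x \<otimes> (inv n \<otimes> m \<otimes> n)) \<otimes> inv n = n \<otimes> ((inv n \<otimes> m \<otimes> n) \<otimes> x) \<otimes> inv n"
      by simp
    then show ?thesis by (simp add: word_simps)
  qed
  have cc: "c x \<otimes> c y = c y \<otimes> c x" if "x \<in> K" "y \<in> K" for x y
  proof -
    have [simp]: "x \<in> carrier G" "c y \<in> carrier G" using that cNH[of y] by auto
    have "inv x \<otimes> c y = c y \<otimes> inv x" using comm[of "inv x" "c y"] cNH that by blast
    then have "(n \<otimes> x \<otimes> inv n) \<otimes> (inv x \<otimes> c y) = (n \<otimes> x \<otimes> inv n) \<otimes> c y \<otimes> inv x"
      by (simp add: m_assoc)
    also have "\<dots> = c y \<otimes> (n \<otimes> x \<otimes> inv n) \<otimes> inv x"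
      using comm'[OF that(1) cNH[OF that(2)]] by simp
    finally show ?thesis by (simp add: c_def[of x] m_assoc)
  qed
  \<comment> \<open>\<open>Z\<close> is the centraliser of \<open>n\<close>; it remains to put the
    commutators generating \<open>[K, K]\<close> into it.\<close>
  define Z where "Z = {z \<in> carrier G. n \<otimes> z \<otimes> inv n = z}"
  have Z: "subgroup Z G"
  proof (rule subgroupI)
    show "Z \<noteq> {}" unfolding Z_def using one_closed by force
    fix a b assume "a \<in> Z" "b \<in> Z"
    then have ab: "a \<in> carrier G" "b \<in> carrier G" "n \<otimes> a \<otimes> inv n = a" "n \<otimes> b \<otimes> inv n = b"
      by (auto simp: Z_def)
    have "n \<otimes> (a \<otimes> b) \<otimes> inv n = (n \<otimes> a \<otimes> inv n) \<otimes> (n \<otimes> b \<otimes> inv n)"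
      using ab(1,2) by (simp add: word_simps)
    then show "a \<otimes> b \<in> Z" using ab by (simp add: Z_def)
    have "n \<otimes> inv a \<otimes> inv n = inv (n \<otimes> a \<otimes> inv n)"
      using ab(1,2) by (simp add: word_simps)
    then show "inv a \<in> Z" using ab by (simp add: Z_def)
  qed (auto simp: Z_def)
  have "derived G K \<subseteq> Z"
    unfolding derived_def
  proof (rule generate_subgroup_incl[OF _ Z], clarify)
    fix x y assume x: "x \<in> K" and y: "y \<in> K"
    have [simp]: "x \<in> carrier G" "y \<in> carrier G" "c x \<in> carrier G" "c y \<in> carrier G"
      using x y cNH[of x] cNH[of y] by auto
    have x': "n \<otimes> x \<otimes> inv n = c x \<otimes> x" and y': "n \<otimes> y \<otimes> inv n = c y \<otimes> y"
      by (simp_all add: c_def word_simps)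
    have 1: "inv x \<otimes> inv (c x) = inv (c x) \<otimes> inv x"
      using comm[OF x, of "c x"] cNH[OF x] by (simp flip: inv_mult_group)
    have 2: "x \<otimes> c y = c y \<otimes> x" "y \<otimes> inv (c x) = inv (c x) \<otimes> y"
      using comm[OF x, of "c y"] comm[OF y, of "inv (c x)"] cNH[OF x] cNH[OF y] by auto
    \<comment> \<open>The aim is that \<open>n\<close> fixes \<open>[x, y]\<close> under
      conjugation. Each conjugate \<open>n x n^-1\<close> is replaced by \<open>c x\<close> times
      \<open>x\<close>. The \<open>c\<close>-factors commute with \<open>K\<close> and with each
      other, so they can be collected and cancelled.\<close>
    have "n \<otimes> (x \<otimes> y \<otimes> inv x \<otimes> inv y) \<otimes> inv n =
      (n \<otimes> x \<otimes> inv n) \<otimes> (n \<otimes> y \<otimes> inv n) \<otimes> inv (n \<otimes> x \<otimes> inv n) \<otimes> inv (n \<otimes> y \<otimes> inv n)"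
      by (simp add: word_simps)
    also have "\<dots> = c x \<otimes> (x \<otimes> c y) \<otimes> y \<otimes> (inv x \<otimes> inv (c x)) \<otimes> inv y \<otimes> inv (c y)"
      by (simp add: x' y' word_simps)
    also have "\<dots> = c x \<otimes> c y \<otimes> x \<otimes> (y \<otimes> inv (c x)) \<otimes> inv x \<otimes> inv y \<otimes> inv (c y)"
      by (simp only: 1 2(1)) (simp add: m_assoc)
    also have "\<dots> = c x \<otimes> c y \<otimes> x \<otimes> (inv (c x) \<otimes> y) \<otimes> inv x \<otimes> inv y \<otimes> inv (c y)"
      by (simp only: 2)
    also have "\<dots> = c x \<otimes> c y \<otimes> (x \<otimes> inv (c x)) \<otimes> y \<otimes> inv x \<otimes> inv y \<otimes> inv (c y)"
      by (simp add: m_assoc)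
    also have "x \<otimes> inv (c x) = inv (c x) \<otimes> x"
      using comm[OF x, of "inv (c x)"] cNH[OF x] by auto
    also have "c x \<otimes> c y \<otimes> (inv (c x) \<otimes> x) \<otimes> y \<otimes> inv x \<otimes> inv y \<otimes> inv (c y) =
       (c x \<otimes> c y) \<otimes> inv (c x) \<otimes> ((x \<otimes> y \<otimes> inv x \<otimes> inv y) \<otimes> inv (c y))"
      by (simp add: m_assoc)
    also have "c x \<otimes> c y = c y \<otimes> c x" using cc x y by blast
    also have "(x \<otimes> y \<otimes> inv x \<otimes> inv y) \<otimes> inv (c y) = inv (c y) \<otimes> (x \<otimes> y \<otimes> inv x \<otimes> inv y)"
      using comm[of "x \<otimes> y \<otimes> inv x \<otimes> inv y" "inv (c y)"] cNH[OF y] x y by auto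
    finally show "x \<otimes> y \<otimes> inv x \<otimes> inv y \<in> Z"
      by (simp add: Z_def m_assoc)
  qed
  then have "n \<otimes> k \<otimes> inv n = k" using K(3) \<open>k \<in> K\<close> by (auto simp: Z_def)
  then have "n \<otimes> k \<otimes> inv n \<otimes> n = k \<otimes> n" by simp
  then show ?thesis using \<open>k \<in> K\<close> by (simp add: m_assoc)
qed

lemma centraliser_subgroup:
  assumes "B \<subseteq> carrier G"
  shows "subgroup (centraliser G B) G"
proof (rule subgroupI)
  show "centraliser G B \<noteq> {}"
    using assms one_closed by (force simp: centraliser_def subset_iff)
  fix a b assume ab: "a \<in> centraliser G B" "b \<in> centraliser G B"
  have "a \<otimes> b \<otimes> x = x \<otimes> (a \<otimes> b)" if "x \<in> B" for x
  proof -
    have c: "a \<in> carrier G" "b \<in> carrier G" "x \<in> carrier G" "a \<otimes> x = x \<otimes> a" "b \<otimes> x = x \<otimes> b"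
      using ab that assms by (auto simp: centraliser_def)
    then have "a \<otimes> b \<otimes> x = (a \<otimes> x) \<otimes> b" using m_assoc by metis
    also have "\<dots> = x \<otimes> a \<otimes> b" using c(4) by simp
    finally show ?thesis using c by (simp add: m_assoc)
  qed
  then show "a \<otimes> b \<in> centraliser G B" using ab by (auto simp: centraliser_def)
  have "inv a \<otimes> x = x \<otimes> inv a" if "x \<in> B" for x
  proof -
    have c: "a \<in> carrier G" "x \<in> carrier G" "a \<otimes> x = x \<otimes> a"
      using ab that assms by (auto simp: centraliser_def)
    then have "inv a \<otimes> (x \<otimes> a) \<otimes> inv a = x \<otimes> inv a" by (metis cancel_left(1) m_closed)
    then show ?thesis using c by (simp add: m_assoc)
  qed
  then show "inv a \<in> centraliser G B" using ab by (auto simp: centraliser_def)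
qed (auto simp: centraliser_def)

lemma centre_normal: "centraliser G (carrier G) \<lhd> G"
proof (rule normal_invI[OF centraliser_subgroup[OF order_refl]])
  fix x h assume x: "x \<in> carrier G" and h: "h \<in> centraliser G (carrier G)"
  then have "x \<otimes> h \<otimes> inv x = h" by (auto simp: centraliser_def m_assoc)
  then show "x \<otimes> h \<otimes> inv x \<in> centraliser G (carrier G)" using h by simp
qed

end

text \<open>The image of \<open>N\<close> in the simple quotient by the centre \<open>Z\<close> is
  trivial or everything. In the first case \<open>N\<close> is central. In the second
  \<open>A = Z N\<close>, so every commutator of \<open>A\<close> is one of \<open>N\<close>, and
  \<open>A\<close> is perfect.\<close>

lemma quasisimple_normal:
  assumes "quasisimple A" "N \<lhd> A"
  shows "N = carrier A \<or> N \<subseteq> centraliser A (carrier A)"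
proof -
  interpret group A using assms(1) by (simp add: quasisimple_def)
  let ?Z = "centraliser A (carrier A)"
  have simple: "simple_group (A Mod ?Z)" and perf: "derived A (carrier A) = carrier A"
    using assms(1) by (auto simp: quasisimple_def)
  have ZN: "?Z <#>\<^bsub>A\<^esub> N \<lhd> A"
    using centre_normal assms(2) by (rule normal_set_mult_normal)
  have sub: "?Z \<subseteq> ?Z <#>\<^bsub>A\<^esub> N" "N \<subseteq> ?Z <#>\<^bsub>A\<^esub> N"
  proof -
    have "\<one>\<^bsub>A\<^esub> \<in> N" "\<one>\<^bsub>A\<^esub> \<in> ?Z" "N \<subseteq> carrier A" "?Z \<subseteq> carrier A"
      using assms(2) centre_normal by (auto simp: normal_inv_iff subgroup.one_closed subgroup.mem_carrier)
    then show "?Z \<subseteq> ?Z <#>\<^bsub>A\<^esub> N" "N \<subseteq> ?Z <#>\<^bsub>A\<^esub> N"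
      unfolding set_mult_def by (force simp: subset_iff)+
  qed
  have "rcosets\<^bsub>A\<lparr>carrier := ?Z <#>\<^bsub>A\<^esub> N\<rparr>\<^esub> ?Z \<lhd> A Mod ?Z"
    using centre_normal sub(1) ZN by (rule normality_factorization)
  then have "rcosets\<^bsub>A\<lparr>carrier := ?Z <#>\<^bsub>A\<^esub> N\<rparr>\<^esub> ?Z = carrier (A Mod ?Z)
    \<or> rcosets\<^bsub>A\<lparr>carrier := ?Z <#>\<^bsub>A\<^esub> N\<rparr>\<^esub> ?Z = {\<one>\<^bsub>A Mod ?Z\<^esub>}"
    using simple simple_group.no_real_normal_subgroup by blast
  then consider (full) "rcosets\<^bsub>A\<lparr>carrier := ?Z <#>\<^bsub>A\<^esub> N\<rparr>\<^esub> ?Z = rcosets\<^bsub>A\<^esub> ?Z"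
    | (triv) "rcosets\<^bsub>A\<lparr>carrier := ?Z <#>\<^bsub>A\<^esub> N\<rparr>\<^esub> ?Z = {?Z}"
    by (auto simp: FactGroup_def)
  then show ?thesis
  proof cases
    case triv
    have "N \<subseteq> ?Z"
    proof
      fix n assume n: "n \<in> N"
      then have "?Z #>\<^bsub>A\<^esub> n \<in> rcosets\<^bsub>A\<lparr>carrier := ?Z <#>\<^bsub>A\<^esub> N\<rparr>\<^esub> ?Z"
        using sub(2) by (auto simp: RCOSETS_def r_coset_def)
      then have "?Z #>\<^bsub>A\<^esub> n = ?Z"
        using triv by simp
      then show "n \<in> ?Z"
        using n assms(2) by (metis centre_normal normal_imp_subgroup repr_independenceD subgroup.mem_carrier rcos_self)
    qed
    then show ?thesis by blast
  next
    case full
    \<comment> \<open>This is \<open>A = Z N\<close>, unfolded from the equality of the two sets of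
      cosets.\<close>
    have cov: "\<exists>z\<in>?Z. \<exists>n\<in>N. x = z \<otimes>\<^bsub>A\<^esub> n" if x: "x \<in> carrier A" for x
    proof -
      have "?Z #>\<^bsub>A\<^esub> x \<in> rcosets\<^bsub>A\<lparr>carrier := ?Z <#>\<^bsub>A\<^esub> N\<rparr>\<^esub> ?Z"
        unfolding full using x by (auto simp: RCOSETS_def)
      then obtain y where y: "y \<in> ?Z <#>\<^bsub>A\<^esub> N" "?Z #>\<^bsub>A\<^esub> x = ?Z #>\<^bsub>A\<^esub> y"
        by (auto simp: RCOSETS_def r_coset_def)
      have "x \<in> ?Z #>\<^bsub>A\<^esub> x"
        using x centre_normal normal_imp_subgroup by (intro rcos_self) auto
      then obtain z where z: "z \<in> ?Z" "x = z \<otimes>\<^bsub>A\<^esub> y"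
        using y(2) by (auto simp: r_coset_def)
      obtain z' n where zn: "z' \<in> ?Z" "n \<in> N" "y = z' \<otimes>\<^bsub>A\<^esub> n"
        using y(1) by (auto simp: set_mult_def)
      have "n \<in> carrier A" using zn(2) subgroup.mem_carrier[OF normal_imp_subgroup[OF assms(2)]] by blast
      moreover have "z \<in> carrier A" "z' \<in> carrier A"
        using z(1) zn(1) by (simp_all add: centraliser_def)
      ultimately have "x = (z \<otimes>\<^bsub>A\<^esub> z') \<otimes>\<^bsub>A\<^esub> n"
        unfolding z(2) zn(3) by (simp add: m_assoc)
      moreover have "z \<otimes>\<^bsub>A\<^esub> z' \<in> ?Z"
        using z(1) zn(1) subgroup.m_closed[OF normal_imp_subgroup[OF centre_normal]] by blast
      ultimately show ?thesis using zn by blast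
    qed
    have sN: "subgroup N A" using assms(2) by (rule normal_imp_subgroup)
    have "derived A (carrier A) \<subseteq> N"
      unfolding derived_def
    proof (rule generate_subgroup_incl[OF _ sN], clarify)
      fix x y assume "x \<in> carrier A" "y \<in> carrier A"
      then obtain z n w m where *: "z \<in> ?Z" "n \<in> N" "x = z \<otimes>\<^bsub>A\<^esub> n" "w \<in> ?Z" "m \<in> N" "y = w \<otimes>\<^bsub>A\<^esub> m"
        using cov by meson
      have [simp]: "z \<in> carrier A" "n \<in> carrier A" "w \<in> carrier A" "m \<in> carrier A"
        using * sN by (auto simp: centraliser_def subgroup.mem_carrier)
      have zc: "z \<otimes>\<^bsub>A\<^esub> g = g \<otimes>\<^bsub>A\<^esub> z" "w \<otimes>\<^bsub>A\<^esub> g = g \<otimes>\<^bsub>A\<^esub> w" if "g \<in> carrier A" for g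
        using * that by (auto simp: centraliser_def)
      \<comment> \<open>The central factors \<open>z\<close> and \<open>w\<close> drop out, leaving
        the commutator of \<open>n\<close> and \<open>m\<close>.\<close>
      have "x \<otimes>\<^bsub>A\<^esub> y \<otimes>\<^bsub>A\<^esub> inv\<^bsub>A\<^esub> x \<otimes>\<^bsub>A\<^esub> inv\<^bsub>A\<^esub> y =
         z \<otimes>\<^bsub>A\<^esub> (n \<otimes>\<^bsub>A\<^esub> w \<otimes>\<^bsub>A\<^esub> m \<otimes>\<^bsub>A\<^esub> inv\<^bsub>A\<^esub> n) \<otimes>\<^bsub>A\<^esub> inv\<^bsub>A\<^esub> z \<otimes>\<^bsub>A\<^esub> inv\<^bsub>A\<^esub> m \<otimes>\<^bsub>A\<^esub> inv\<^bsub>A\<^esub> w"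
        using * by (simp add: word_simps)
      also have "\<dots> = n \<otimes>\<^bsub>A\<^esub> (w \<otimes>\<^bsub>A\<^esub> (m \<otimes>\<^bsub>A\<^esub> inv\<^bsub>A\<^esub> n \<otimes>\<^bsub>A\<^esub> inv\<^bsub>A\<^esub> m)) \<otimes>\<^bsub>A\<^esub> inv\<^bsub>A\<^esub> w"
        using zc(1)[of "n \<otimes>\<^bsub>A\<^esub> w \<otimes>\<^bsub>A\<^esub> m \<otimes>\<^bsub>A\<^esub> inv\<^bsub>A\<^esub> n"] by (simp add: word_simps)
      also have "\<dots> = n \<otimes>\<^bsub>A\<^esub> m \<otimes>\<^bsub>A\<^esub> inv\<^bsub>A\<^esub> n \<otimes>\<^bsub>A\<^esub> inv\<^bsub>A\<^esub> m"
        using zc(2)[of "m \<otimes>\<^bsub>A\<^esub> inv\<^bsub>A\<^esub> n \<otimes>\<^bsub>A\<^esub> inv\<^bsub>A\<^esub> m"] by (simp add: word_simps)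
      also have "\<dots> \<in> N"
        using * sN by (auto simp: subgroup.m_closed subgroup.m_inv_closed)
      finally show "x \<otimes>\<^bsub>A\<^esub> y \<otimes>\<^bsub>A\<^esub> inv\<^bsub>A\<^esub> x \<otimes>\<^bsub>A\<^esub> inv\<^bsub>A\<^esub> y \<in> N" .
    qed
    then show ?thesis using perf sN subgroup.subset by blast
  qed
qed

context group
begin

lemma subnormal_subgroup_in:
  "subgroup H G \<Longrightarrow> subnormal (G\<lparr>carrier := H\<rparr>) X \<Longrightarrow> subgroup X G \<and> X \<subseteq> H"
  using group.subnormal_subgroup[OF subgroup_imp_group] incl_subgroup subgroup.subset by fastforce

text \<open>For subgroups of a finite group this amounts to quasisimplicity; stated without the quotient
  by the centre, it is easily seen to be invariant under conjugation.\<close>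

definition quasisimple_in :: "'a set \<Rightarrow> bool" where
  "quasisimple_in X \<longleftrightarrow> derived G X = X \<and> X \<noteq> {\<one>} \<and>
    (\<forall>N. N \<lhd> G\<lparr>carrier := X\<rparr> \<longrightarrow> X \<subseteq> N \<or> (\<forall>x\<in>X. \<forall>n\<in>N. x \<otimes> n = n \<otimes> x))"

lemma quasisimple_in_if_quasisimple:
  assumes X: "subgroup X G" and q: "quasisimple (G\<lparr>carrier := X\<rparr>)"
  shows "quasisimple_in X"
proof -
  \<comment> \<open>A trivial \<open>X\<close> has only one coset of its centre, whereas a simple
    group has order greater than 1.\<close>
  have "X \<noteq> {\<one>}"
  proof
    assume "X = {\<one>}"
    moreover have "simple_group (G\<lparr>carrier := X\<rparr> Mod centraliser (G\<lparr>carrier := X\<rparr>) X)"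
      using q by (simp add: quasisimple_def)
    ultimately have "1 < card (rcosets\<^bsub>G\<lparr>carrier := X\<rparr>\<^esub> (centraliser (G\<lparr>carrier := X\<rparr>) X))"
      "X = {\<one>}"
      using simple_group.order_gt_one by (fastforce simp: order_def FactGroup_def)+
    then show False
      by (simp add: RCOSETS_def)
  qed
  moreover have "derived G X = X"
    using q derived_consistent[OF order_refl X] by (simp add: quasisimple_def)
  moreover have "X \<subseteq> N \<or> (\<forall>x\<in>X. \<forall>n\<in>N. x \<otimes> n = n \<otimes> x)" if "N \<lhd> G\<lparr>carrier := X\<rparr>" for N
    using quasisimple_normal[OF q that] by (auto simp: centraliser_def)
  ultimately show ?thesis
    by (simp add: quasisimple_in_def)
qed

text \<open>The dichotomy holds in \<open>K\<close> by quasisimplicity and is carried up the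
  subnormal chain. If \<open>M\<close> is normal in \<open>L\<close> and \<open>N\<close> in
  \<open>L\<close>, then \<open>N \<inter> M\<close> is normal in \<open>M\<close>; should
  \<open>K\<close> only commute with \<open>N \<inter> M\<close>,
  \<open>normal_or_commutes_step\<close> extends this to \<open>N\<close>.\<close>

lemma component_in_normal_or_commutes:
  assumes H: "subgroup H G" and sn: "subnormal (G\<lparr>carrier := H\<rparr>) K" and K: "quasisimple_in K"
    and N: "N \<lhd> G\<lparr>carrier := H\<rparr>"
  shows "K \<subseteq> N \<or> (\<forall>k\<in>K. \<forall>n\<in>N. k \<otimes> n = n \<otimes> k)"
proof -
  let ?P = "\<lambda>L. \<forall>N. N \<lhd> G\<lparr>carrier := L\<rparr> \<longrightarrow> K \<subseteq> N \<or> (\<forall>k\<in>K. \<forall>n\<in>N. k \<otimes> n = n \<otimes> k)"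
  have sK: "subgroup K G" using subnormal_subgroup_in[OF H sn] by blast
  have perf: "derived G K = K" and base: "?P K"
    using K by (simp_all add: quasisimple_in_def)
  \<comment> \<open>The induction on \<open>subnormal\<close> starts at \<open>H\<close> and goes
    down. Hence the statement proved for each \<open>L\<close> is an implication that transports the
    dichotomy from \<open>L\<close> up to \<open>H\<close>.\<close>
  have "K \<subseteq> L \<longrightarrow> ?P L \<longrightarrow> ?P H" if "subnormal (G\<lparr>carrier := H\<rparr>) L" for L
    using that
  proof (induction rule: subnormal.induct)
    case whole
    then show ?case by simp
  next
    case (step L M)
    have sL: "subgroup L G" using subnormal_subgroup_in[OF H step(1)] by blast
    have nM: "M \<lhd> G\<lparr>carrier := L\<rparr>" using step(2) by simp
    note M = normal_in_iff[THEN iffD1, OF sL nM]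
    have "K \<subseteq> N \<or> (\<forall>k\<in>K. \<forall>n\<in>N. k \<otimes> n = n \<otimes> k)"
      if KM: "K \<subseteq> M" and PM: "?P M" and N: "N \<lhd> G\<lparr>carrier := L\<rparr>" for N
    proof -
      note N' = normal_in_iff[THEN iffD1, OF sL N]
      have sM: "subgroup M G" using M by blast
      have "N \<inter> M \<lhd> G\<lparr>carrier := M\<rparr>"
        unfolding normal_in_iff[OF sM]
        using N' M subgroups_Inter_pair subgroup.m_closed[OF sM] subgroup.m_inv_closed[OF sM]
        by (auto simp: subset_iff)
      then consider "K \<subseteq> N \<inter> M" | "\<forall>k\<in>K. \<forall>n\<in>N \<inter> M. k \<otimes> n = n \<otimes> k"
        using PM by blast
      then show ?thesis
      proof cases
        case 2
        then show ?thesis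
          using normal_or_commutes_step[OF sL nM N sK KM perf] by blast
      qed blast
    qed
    then have "K \<subseteq> M \<longrightarrow> ?P M \<longrightarrow> ?P L" by blast
    then show ?case
      using step.IH M by (meson subset_trans)
  qed
  then have "?P H" using sn base by blast
  then show ?thesis using N by blast
qed

end

section \<open>The generalised Fitting subgroup\<close>

context group
begin

lemma p_group_subgroup:
  assumes N: "subgroup N G" "p_group p (G\<lparr>carrier := N\<rparr>)" and M: "subgroup M G" "M \<subseteq> N" and p: "prime p"
  shows "p_group p (G\<lparr>carrier := M\<rparr>)"
proof -
  have "subgroup M (G\<lparr>carrier := N\<rparr>)"
    using subgroup_incl[OF M(1) N(1) M(2)] .
  then have "card (rcosets\<^bsub>G\<lparr>carrier := N\<rparr>\<^esub> M) * card M = card N"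
    using group.lagrange[OF subgroup_imp_group[OF N(1)]] by (simp add: order_def)
  then have "card M dvd card N"
    by (metis dvd_triv_right)
  then show ?thesis
    using N(2) divides_primepow_nat[OF p] unfolding p_group_iff[OF N(1)] p_group_iff[OF M(1)] by metis
qed

lemma subnormal_trans: "subnormal (G\<lparr>carrier := N\<rparr>) K \<Longrightarrow> subnormal G N \<Longrightarrow> subnormal G K"
proof (induction rule: subnormal.induct)
  case whole
  then show ?case by simp
next
  case (step K H)
  then show ?case by (auto intro: subnormal.step)
qed

text \<open>A nontrivial subnormal subgroup \<open>S\<close> of least order is simple. If it is
  abelian, it has prime order \<open>p\<close> and lies in \<open>O\<^sub>p\<close>; otherwise it is
  perfect with trivial centre and hence a component.\<close>

lemma ex_p_core_or_component:
  assumes fin: "finite (carrier G)" and nontriv: "carrier G \<noteq> {\<one>}"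
    and no_comp: "\<And>K. subnormal G K \<Longrightarrow> \<not> quasisimple (G\<lparr>carrier := K\<rparr>)"
  shows "\<exists>p. prime p \<and> Op p (carrier G) \<noteq> {\<one>}"
proof -
  have "\<exists>S. (subnormal G S \<and> S \<noteq> {\<one>}) \<and> (\<forall>T. subnormal G T \<and> T \<noteq> {\<one>} \<longrightarrow> card S \<le> card T)"
    using ex_has_least_nat[of "\<lambda>S. subnormal G S \<and> S \<noteq> {\<one>}" "carrier G" card] nontriv
    by (auto intro: subnormal.whole)
  then obtain S where S: "subnormal G S" "S \<noteq> {\<one>}"
    and min: "\<And>T. subnormal G T \<Longrightarrow> T \<noteq> {\<one>} \<Longrightarrow> card S \<le> card T" by blast
  interpret sS: subgroup S G using S(1) by (rule subnormal_subgroup)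
  have sub: "subgroup S G" ..
  interpret S: group "G\<lparr>carrier := S\<rparr>" using sub by (rule subgroup_imp_group)
  have finS: "finite S" using fin sS.subset finite_subset by blast
  have simple: "N = S \<or> N = {\<one>}" if N: "N \<lhd> G\<lparr>carrier := S\<rparr>" for N
  proof (rule disjCI)
    assume "N \<noteq> {\<one>}"
    then have "card S \<le> card N" using min subnormal.step[OF S(1) N] by blast
    moreover have "N \<subseteq> S" using N normal_in_iff[OF sub] by blast
    ultimately show "N = S" using finS card_seteq by blast
  qed
  obtain x where "x \<in> S" "x \<noteq> \<one>"
    using S(2) sS.one_closed by blast
  then have "card {\<one>, x} \<le> card S"
    using finS by (intro card_mono) auto
  then have card: "1 < card S"
    using \<open>x \<noteq> \<one>\<close> by simp
  have sg: "simple_group (G\<lparr>carrier := S\<rparr>)"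
    by unfold_locales (use simple card in \<open>auto simp: order_def\<close>)
  let ?Z = "centraliser (G\<lparr>carrier := S\<rparr>) S"
  have "?Z \<lhd> G\<lparr>carrier := S\<rparr>"
    using S.centre_normal by simp
  then consider (ab) "?Z = S" | (triv) "?Z = {\<one>}"
    using simple by blast
  then show ?thesis
  proof cases
    case ab
    \<comment> \<open>Every subgroup of an abelian group is normal, so a subgroup of prime order
      must be all of \<open>S\<close>.\<close>
    obtain p where p: "prime p" "p dvd card S"
      using card prime_factor_nat[of "card S"] by auto
    then obtain Q where Q: "subgroup Q G" "Q \<subseteq> S" "card Q = p"
      using cauchy[OF sub finS] by blast
    have "h \<otimes> n \<otimes> inv h = n" if "h \<in> S" "n \<in> Q" for h n
    proof -
      have "h \<in> ?Z" using ab that(1) by simp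
      then have "h \<otimes> n = n \<otimes> h" using that Q by (auto simp: centraliser_def)
      then show ?thesis using that Q by (auto simp: m_assoc)
    qed
    then have "Q \<lhd> G\<lparr>carrier := S\<rparr>"
      using Q by (auto simp: normal_in_iff[OF sub])
    moreover have "Q \<noteq> {\<one>}" using Q(3) p(1) by auto
    ultimately have "Q = S" using simple by blast
    then have "p_group p (G\<lparr>carrier := S\<rparr>)"
      using Q(3) by (auto simp: p_group_iff[OF sub] intro: exI[of _ 1])
    then have "S \<subseteq> Op p (carrier G)"
      using subnormal_p_subgroup_le_p_core[OF fin p(1) S(1)] by blast
    then show ?thesis using S(2) sS.one_closed p(1) by blast
  next
    case triv
    have der: "derived G S \<lhd> G\<lparr>carrier := S\<rparr>"
      using sub by (rule derived_subgroup_is_normal)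
    have "derived G S \<noteq> {\<one>}"
    proof
      assume d: "derived G S = {\<one>}"
      have "x \<otimes> y = y \<otimes> x" if "x \<in> S" "y \<in> S" for x y
      proof -
        have "x \<otimes> y \<otimes> inv x \<otimes> inv y \<in> derived G S"
          using that unfolding derived_def by (intro generate.incl) blast
        then have "x \<otimes> y \<otimes> inv x \<otimes> inv y = \<one>" using d by simp
        then have "x \<otimes> y \<otimes> inv x \<otimes> inv y \<otimes> y \<otimes> x = y \<otimes> x" using that by (simp add: m_assoc)
        then show ?thesis using that by (simp add: m_assoc)
      qed
      then have "?Z = S" by (auto simp: centraliser_def)
      then show False using triv S(2) by simp
    qed
    then have perf: "derived G S = S" using simple der by blast
    \<comment> \<open>\<open>quasisimple\<close> asks for simplicity of the quotient by the centre.
      The centre is trivial here, and simplicity is moved along the isomorphism of \<open>S\<close>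
      with its quotient by the identity.\<close>
    have "(the_elem \<in> iso (G\<lparr>carrier := S\<rparr> Mod {\<one>}) (G\<lparr>carrier := S\<rparr>))"
      using S.trivial_factor_iso by simp
    moreover have gq: "group (G\<lparr>carrier := S\<rparr> Mod {\<one>})"
      using normal.factorgroup_is_group[OF S.one_is_normal] by simp
    ultimately obtain h where "h \<in> iso (G\<lparr>carrier := S\<rparr>) (G\<lparr>carrier := S\<rparr> Mod {\<one>})"
      using group.iso_set_sym by blast
    then have "simple_group (G\<lparr>carrier := S\<rparr> Mod ?Z)"
      unfolding triv using simple_group.iso_simple[OF sg gq] by blast
    then have "quasisimple (G\<lparr>carrier := S\<rparr>)"
      using perf derived_consistent[OF order_refl sub] S.group_axioms by (simp add: quasisimple_def)
    then show ?thesis using no_comp S(1) by blast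
  qed
qed

lemma lower_central_normal: "lower_central G i \<lhd> G"
proof (induction i)
  case 0
  then show ?case by (simp add: normal_self)
next
  case (Suc i)
  have sub: "subgroup (lower_central G i) G" using Suc by (rule normal_imp_subgroup)
  show ?case
    unfolding lower_central.simps
  proof (rule normal_generateI, clarify)
    fix h g assume "h \<in> lower_central G i" "g \<in> carrier G"
    then show "h \<otimes> g \<otimes> inv h \<otimes> inv g \<in> carrier G" using subgroup.mem_carrier[OF sub] by simp
  next
    fix z x assume "z \<in> {h \<otimes> g \<otimes> inv h \<otimes> inv g |h g. h \<in> lower_central G i \<and> g \<in> carrier G}" and x: "x \<in> carrier G"
    then obtain h g where z: "z = h \<otimes> g \<otimes> inv h \<otimes> inv g" and h: "h \<in> lower_central G i" and g: "g \<in> carrier G"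
      by blast
    have "x \<otimes> z \<otimes> inv x = (x \<otimes> h \<otimes> inv x) \<otimes> (x \<otimes> g \<otimes> inv x) \<otimes> inv (x \<otimes> h \<otimes> inv x) \<otimes> inv (x \<otimes> g \<otimes> inv x)"
      unfolding z using x g subgroup.mem_carrier[OF sub h] by (simp add: word_simps)
    moreover have "x \<otimes> h \<otimes> inv x \<in> lower_central G i" "x \<otimes> g \<otimes> inv x \<in> carrier G"
      using Suc x h g by (auto simp: normal_inv_iff)
    ultimately show "x \<otimes> z \<otimes> inv x \<in> {h \<otimes> g \<otimes> inv h \<otimes> inv g |h g. h \<in> lower_central G i \<and> g \<in> carrier G}"
      by blast
  qed
qed

lemma normal_set_mult_is_subgroup:
  assumes "N \<lhd> G" "subgroup H G"
  shows "subgroup (N <#> H) G"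
proof -
  interpret second_isomorphism_grp N G H
    using assms by (simp add: second_isomorphism_grp_def second_isomorphism_grp_axioms_def)
  show ?thesis by (rule normal_set_mult_subgroup)
qed

text \<open>With \<open>d' = h d h^-1\<close> and \<open>k' = h k h^-1\<close> the right-hand side
  is \<open>[c, d' k'] d' k'\<close>. If \<open>c\<close> is in a lower central term, the commutator
  falls into the next one.\<close>

lemma conj_mult_commutator:
  assumes "c \<in> carrier G" "h \<in> carrier G" "d \<in> carrier G" "k \<in> carrier G"
  shows "c \<otimes> h \<otimes> (d \<otimes> k) \<otimes> inv (c \<otimes> h) =
    c \<otimes> ((h \<otimes> d \<otimes> inv h) \<otimes> (h \<otimes> k \<otimes> inv h)) \<otimes> inv c \<otimes>
      inv ((h \<otimes> d \<otimes> inv h) \<otimes> (h \<otimes> k \<otimes> inv h)) \<otimes> (h \<otimes> d \<otimes> inv h) \<otimes> (h \<otimes> k \<otimes> inv h)"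
  using assms by (simp add: word_simps)

text \<open>The products of \<open>H\<close> with the terms of the lower central series descend from
  \<open>G\<close> to \<open>H\<close>. Each is normal in the previous one, because commutators of a
  term with \<open>G\<close> lie in the next term.\<close>

lemma nilpotent_imp_subnormal:
  assumes nil: "nilpotent G" and H: "subgroup H G"
  shows "subnormal G H"
proof -
  interpret H: subgroup H G by fact
  have "subnormal G (lower_central G i <#> H)" for i
  proof (induction i)
    case 0
    have "carrier G <#> H = carrier G"
      using H.one_closed by (force simp: set_mult_def)
    then show ?case by (simp add: subnormal.whole)
  next
    case (Suc i)
    let ?L = "lower_central G i" and ?L' = "lower_central G (Suc i)"
    note L = lower_central_normal[of i] and L' = lower_central_normal[of "Suc i"]
    interpret L: subgroup ?L G using L by (rule normal_imp_subgroup)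
    interpret L': subgroup ?L' G using L' by (rule normal_imp_subgroup)
    have comm: "h \<otimes> g \<otimes> inv h \<otimes> inv g \<in> ?L'" if "h \<in> ?L" "g \<in> carrier G" for h g
      using that by (auto intro: generate.incl)
    have "?L' \<subseteq> ?L"
      unfolding lower_central.simps
    proof (rule generate_subgroup_incl[OF _ L.subgroup_axioms], clarify)
      fix h g assume h: "h \<in> ?L" and g: "g \<in> carrier G"
      then have "g \<otimes> inv h \<otimes> inv g \<in> ?L" using L by (simp add: normal_inv_iff)
      then have "h \<otimes> (g \<otimes> inv h \<otimes> inv g) \<in> ?L" by (rule L.m_closed[OF h])
      moreover have "h \<otimes> (g \<otimes> inv h \<otimes> inv g) = h \<otimes> g \<otimes> inv h \<otimes> inv g"
        using L.mem_carrier[OF h] g by (simp only: m_assoc m_closed inv_closed)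
      ultimately show "h \<otimes> g \<otimes> inv h \<otimes> inv g \<in> ?L" by simp
    qed
    then have "?L' <#> H \<subseteq> ?L <#> H" by (auto simp: set_mult_def)
    moreover have "x \<otimes> y \<otimes> inv x \<in> ?L' <#> H" if xy: "x \<in> ?L <#> H" "y \<in> ?L' <#> H" for x y
    proof -
      obtain c h where x: "x = c \<otimes> h" "c \<in> ?L" "h \<in> H" using xy(1) by (auto simp: set_mult_def)
      obtain d k where y: "y = d \<otimes> k" "d \<in> ?L'" "k \<in> H" using xy(2) by (auto simp: set_mult_def)
      have [simp]: "c \<in> carrier G" "h \<in> carrier G" "d \<in> carrier G" "k \<in> carrier G"
        using x y H.mem_carrier L.mem_carrier L'.mem_carrier by blast+
      define d' where "d' = h \<otimes> d \<otimes> inv h"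
      define k' where "k' = h \<otimes> k \<otimes> inv h"
      have d': "d' \<in> ?L'" using y L' by (simp add: d'_def normal_inv_iff)
      have k': "k' \<in> H" using x y by (simp add: k'_def)
      have [simp]: "d' \<in> carrier G" "k' \<in> carrier G" by (simp_all add: d'_def k'_def)
      have "x \<otimes> y \<otimes> inv x = (c \<otimes> (d' \<otimes> k') \<otimes> inv c \<otimes> inv (d' \<otimes> k') \<otimes> d') \<otimes> k'"
        unfolding x(1) y(1) d'_def k'_def by (rule conj_mult_commutator) fact+
      moreover have "c \<otimes> (d' \<otimes> k') \<otimes> inv c \<otimes> inv (d' \<otimes> k') \<otimes> d' \<in> ?L'"
        by (rule L'.m_closed[OF comm[OF x(2)] d']) simp
      ultimately show ?thesis using k' unfolding set_mult_def by blast
    qed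
    ultimately have "?L' <#> H \<lhd> G\<lparr>carrier := ?L <#> H\<rparr>"
      using normal_in_iff[OF normal_set_mult_is_subgroup[OF L H]] normal_set_mult_is_subgroup[OF L' H]
      by blast
    then show ?case by (rule subnormal.step[OF Suc])
  qed
  moreover obtain n where "lower_central G n = {\<one>}"
    using nil by (auto simp: nilpotent_def)
  ultimately have "subnormal G ({\<one>} <#> H)" by metis
  moreover have "{\<one>} <#> H = H"
    by (force simp: set_mult_def)
  ultimately show ?thesis by simp
qed

text \<open>If a prime \<open>q\<close> other than \<open>p\<close> divided the order of
  \<open>N\<close>, a subgroup of order \<open>q\<close> would be subnormal in \<open>N\<close> by
  nilpotency, hence subnormal in \<open>G\<close>, and would lie in the trivial
  \<open>Op q (carrier G)\<close>.\<close>

lemma nilpotent_normal_p_group: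
  assumes fin: "finite (carrier G)" and p: "prime p"
    and triv: "\<And>q. prime q \<Longrightarrow> q \<noteq> p \<Longrightarrow> Op q (carrier G) = {\<one>}"
    and N: "N \<lhd> G" "nilpotent (G\<lparr>carrier := N\<rparr>)"
  shows "p_group p (G\<lparr>carrier := N\<rparr>)"
proof -
  interpret N: subgroup N G using N(1) by (rule normal_imp_subgroup)
  have sub: "subgroup N G" ..
  have finN: "finite N" using fin N.subset finite_subset by blast
  have "q = p" if q: "prime q" "q dvd card N" for q
  proof (rule ccontr)
    assume "q \<noteq> p"
    obtain Q where Q: "subgroup Q G" "Q \<subseteq> N" "card Q = q"
      using cauchy[OF sub finN] q by blast
    have "subnormal (G\<lparr>carrier := N\<rparr>) Q"
      using group.nilpotent_imp_subnormal[OF subgroup_imp_group[OF sub] N(2)] subgroup_incl[OF Q(1) sub Q(2)] by blast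
    moreover have "subnormal G N"
      using N(1) by (intro subnormal.step[OF subnormal.whole]) simp
    ultimately have "subnormal G Q" by (rule subnormal_trans)
    moreover have "p_group q (G\<lparr>carrier := Q\<rparr>)"
      using Q(3) by (auto simp: p_group_iff[OF Q(1)] intro: exI[of _ 1])
    ultimately have "Q \<subseteq> Op q (carrier G)"
      by (rule subnormal_p_subgroup_le_p_core[OF fin q(1)])
    then have "card Q \<le> card {\<one>}"
      using triv[OF q(1) \<open>q \<noteq> p\<close>] by (intro card_mono) auto
    then show False using Q(3) prime_gt_1_nat[OF q(1)] by simp
  qed
  moreover have "card N > 0" using finN N.one_closed by (auto simp: card_gt_0_iff simp del: N.one_closed)
  ultimately show ?thesis
    unfolding p_group_iff[OF sub] using prime_power_if_unique_prime_divisor[OF p] by blast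
qed

text \<open>Without components the layer is trivial, and the subgroups generating the Fitting
  subgroup are \<open>p\<close>-groups inside \<open>Op p (carrier G)\<close>.\<close>

lemma p_group_generalised_fitting:
  assumes fin: "finite (carrier G)" and p: "prime p"
    and triv: "\<And>q. prime q \<Longrightarrow> q \<noteq> p \<Longrightarrow> Op q (carrier G) = {\<one>}"
    and no_comp: "\<And>K. subnormal G K \<Longrightarrow> \<not> quasisimple (G\<lparr>carrier := K\<rparr>)"
  shows "p_group p (G\<lparr>carrier := generalised_fitting G\<rparr>)"
proof -
  note O = p_core_in_subgroup[OF fin p subgroup_self] p_core_in[OF fin p subgroup_self]
  have le: "N \<subseteq> Op p (carrier G)" if "N \<lhd> G" "nilpotent (G\<lparr>carrier := N\<rparr>)" for N
    using O(6) nilpotent_normal_p_group[OF fin p triv that] that(1) by simp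
  then have "fitting G \<subseteq> Op p (carrier G)"
    unfolding fitting_def by (intro generate_subgroup_incl[OF _ O(1)]) blast
  moreover have sF: "subgroup (fitting G) G"
    unfolding fitting_def using le O(2) by (intro generate_is_subgroup) blast
  ultimately have "p_group p (G\<lparr>carrier := fitting G\<rparr>)"
    using p_group_subgroup[OF O(1) O(5) sF _ p] by blast
  moreover have "layer G = {\<one>}"
  proof -
    have "{K. subnormal G K \<and> quasisimple (G\<lparr>carrier := K\<rparr>)} = {}" using no_comp by blast
    then show ?thesis unfolding layer_def by (simp only: Union_empty generate_empty)
  qed
  moreover have "fitting G <#> {\<one>} = fitting G"
    using subgroup.mem_carrier[OF sF] by (force simp: set_mult_def)
  ultimately show ?thesis by (simp add: generalised_fitting_def)
qed

end

section \<open>Conjugates of subnormal and quasisimple subgroups\<close>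

context group
begin

abbreviation conj_by :: "'a \<Rightarrow> 'a set \<Rightarrow> 'a set" where
  "conj_by a N \<equiv> (\<lambda>n. a \<otimes> n \<otimes> inv a) ` N"

lemma conj_by_inv:
  assumes "N \<subseteq> carrier G" "a \<in> carrier G"
  shows "conj_by (inv a) (conj_by a N) = N" "conj_by a (conj_by (inv a) N) = N"
proof -
  have "inv a \<otimes> (a \<otimes> n \<otimes> inv a) \<otimes> inv (inv a) = n" "a \<otimes> (inv a \<otimes> n \<otimes> inv (inv a)) \<otimes> inv a = n"
    if "n \<in> N" for n
    using assms that by (simp_all add: word_simps subset_iff)
  then show "conj_by (inv a) (conj_by a N) = N" "conj_by a (conj_by (inv a) N) = N"
    by (simp_all add: image_image)
qed

lemma normal_conj_by:
  assumes X: "subgroup X G" and N: "N \<lhd> G\<lparr>carrier := X\<rparr>" and [simp]: "a \<in> carrier G"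
  shows "conj_by a N \<lhd> G\<lparr>carrier := conj_by a X\<rparr>"
proof -
  note N = normal_in_iff[THEN iffD1, OF X N]
  have "(a \<otimes> x \<otimes> inv a) \<otimes> (a \<otimes> n \<otimes> inv a) \<otimes> inv (a \<otimes> x \<otimes> inv a) \<in> conj_by a N"
    if x: "x \<in> X" and n: "n \<in> N" for x n
  proof -
    have "x \<in> carrier G" "n \<in> carrier G" using x n N X by (meson subgroup.mem_carrier)+
    then have "(a \<otimes> x \<otimes> inv a) \<otimes> (a \<otimes> n \<otimes> inv a) \<otimes> inv (a \<otimes> x \<otimes> inv a) = a \<otimes> (x \<otimes> n \<otimes> inv x) \<otimes> inv a"
      by (simp add: word_simps)
    then show ?thesis using N x n by simp
  qed
  then show ?thesis
    using N conj_image_subgroup[of N a] by (auto simp: normal_in_iff[OF conj_image_subgroup[OF X assms(3)]])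
qed

lemma normal_conj_by_eq:
  assumes A: "subgroup A G" and K: "K \<lhd> G\<lparr>carrier := A\<rparr>" and a: "a \<in> A"
  shows "conj_by a K = K"
proof
  note K = normal_in_iff[THEN iffD1, OF A K]
  have "inv a \<in> A" "a \<in> carrier G" using A a by (auto simp: subgroup.m_inv_closed subgroup.mem_carrier)
  show "conj_by a K \<subseteq> K" using K a by blast
  have "conj_by (inv a) K \<subseteq> K" using K \<open>inv a \<in> A\<close> by blast
  then have "conj_by a (conj_by (inv a) K) \<subseteq> conj_by a K" by (rule image_mono)
  then show "K \<subseteq> conj_by a K"
    using conj_by_inv(2)[OF subgroup.subset \<open>a \<in> carrier G\<close>, of K] K by blast
qed

text \<open>The chain is conjugated link by link; its top \<open>K\<close> is mapped to
  itself.\<close>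

lemma subnormal_conj_by:
  assumes K: "subgroup K G" and a: "a \<in> carrier G" "conj_by a K = K"
    and X: "subnormal (G\<lparr>carrier := K\<rparr>) X"
  shows "subnormal (G\<lparr>carrier := K\<rparr>) (conj_by a X)"
  using X
proof (induction rule: subnormal.induct)
  case whole
  then show ?case using subnormal.whole[of "G\<lparr>carrier := K\<rparr>"] a by simp
next
  case (step L X)
  have "subgroup L G" using subnormal_subgroup_in[OF K step(1)] by blast
  then show ?case
    using step normal_conj_by[of L X a] a(1) by (intro subnormal.step[OF step.IH]) simp
qed

lemma subnormal_restrict:
  assumes H: "subgroup H G" and K: "subgroup K G" "K \<subseteq> H" and X: "subnormal (G\<lparr>carrier := H\<rparr>) X"
  shows "subnormal (G\<lparr>carrier := K\<rparr>) (X \<inter> K)"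
  using X
proof (induction rule: subnormal.induct)
  case whole
  then show ?case using subnormal.whole[of "G\<lparr>carrier := K\<rparr>"] K(2) by (simp add: Int_absorb1)
next
  case (step L X)
  have "subgroup L G" using subnormal_subgroup_in[OF H step(1)] by blast
  then show ?case
    using step normal_inter[of L K X] K(1) by (intro subnormal.step[OF step.IH]) simp
qed

text \<open>Conjugation by \<open>a\<close> is undone by \<open>inv a\<close>: what is claimed of
  the conjugate is pulled back, settled in \<open>X\<close> and carried forward again.\<close>

lemma quasisimple_in_conj_by:
  assumes X: "subgroup X G" "quasisimple_in X" and a [simp]: "a \<in> carrier G"
  shows "quasisimple_in (conj_by a X)"
proof -
  interpret X: subgroup X G by fact
  have sX: "subgroup (conj_by a X) G" using X(1) a by (rule conj_image_subgroup)
  have "derived G (conj_by a X) = conj_by a X"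
  proof
    show "derived G (conj_by a X) \<subseteq> conj_by a X"
      using sX derived_incl[OF order_refl] by blast
    let ?D = "derived G (conj_by a X)"
    interpret D: subgroup ?D G
      using sX subgroup.subset derived_is_subgroup by blast
    have inv: "conj_by (inv a) ?D \<subseteq> carrier G" using D.subset by auto
    have sD: "subgroup (conj_by (inv a) ?D) G"
      by (rule conj_image_subgroup[OF D.subgroup_axioms]) simp
    have "derived G X \<subseteq> conj_by (inv a) ?D"
      unfolding derived_def[of G X]
    proof (rule generate_subgroup_incl[OF _ sD], clarify)
      fix x y assume xy: "x \<in> X" "y \<in> X"
      let ?x = "a \<otimes> x \<otimes> inv a" and ?y = "a \<otimes> y \<otimes> inv a"
      have "?x \<otimes> ?y \<otimes> inv ?x \<otimes> inv ?y \<in> ?D"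
        unfolding derived_def using xy by (intro generate.incl) blast
      then have "inv a \<otimes> (?x \<otimes> ?y \<otimes> inv ?x \<otimes> inv ?y) \<otimes> inv (inv a) \<in> conj_by (inv a) ?D" by blast
      then show "x \<otimes> y \<otimes> inv x \<otimes> inv y \<in> conj_by (inv a) ?D"
        using xy by (simp add: word_simps)
    qed
    then have "conj_by a X \<subseteq> conj_by a (conj_by (inv a) ?D)"
      using X(2) unfolding quasisimple_in_def by (metis image_mono)
    then show "conj_by a X \<subseteq> ?D"
      using conj_by_inv(2)[OF D.subset a] by simp
  qed
  moreover have "conj_by a X \<noteq> {\<one>}"
  proof
    assume "conj_by a X = {\<one>}"
    then have "conj_by (inv a) (conj_by a X) = {inv a \<otimes> \<one> \<otimes> inv (inv a)}" by simp
    then have "X = {\<one>}" using conj_by_inv(1)[OF X.subset a] by simp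
    then show False using X(2) by (simp add: quasisimple_in_def)
  qed
  moreover have "conj_by a X \<subseteq> N \<or> (\<forall>x\<in>conj_by a X. \<forall>n\<in>N. x \<otimes> n = n \<otimes> x)"
    if N: "N \<lhd> G\<lparr>carrier := conj_by a X\<rparr>" for N
  proof -
    have "conj_by (inv a) N \<lhd> G\<lparr>carrier := conj_by (inv a) (conj_by a X)\<rparr>"
      using sX N by (rule normal_conj_by) simp
    then have "conj_by (inv a) N \<lhd> G\<lparr>carrier := X\<rparr>"
      using conj_by_inv(1)[OF X.subset a] by simp
    then consider "X \<subseteq> conj_by (inv a) N" | "\<forall>x\<in>X. \<forall>n\<in>conj_by (inv a) N. x \<otimes> n = n \<otimes> x"
      using X(2) by (auto simp: quasisimple_in_def)
    moreover have NC: "N \<subseteq> carrier G"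
      using N normal_in_iff[OF sX] sX subgroup.subset by blast
    ultimately show ?thesis
    proof cases
      case 1
      then have "conj_by a X \<subseteq> conj_by a (conj_by (inv a) N)" by (rule image_mono)
      then show ?thesis using conj_by_inv(2)[OF NC a] by simp
    next
      case 2
      have "(a \<otimes> x \<otimes> inv a) \<otimes> n = n \<otimes> (a \<otimes> x \<otimes> inv a)" if "x \<in> X" "n \<in> N" for x n
      proof -
        have [simp]: "x \<in> carrier G" "n \<in> carrier G" using that NC by auto
        have "x \<otimes> (inv a \<otimes> n \<otimes> inv (inv a)) = (inv a \<otimes> n \<otimes> inv (inv a)) \<otimes> x" using 2 that by blast
        then have "a \<otimes> (x \<otimes> (inv a \<otimes> n \<otimes> inv (inv a))) \<otimes> inv a = a \<otimes> ((inv a \<otimes> n \<otimes> inv (inv a)) \<otimes> x) \<otimes> inv a"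
          by simp
        then show ?thesis by (simp add: word_simps)
      qed
      then show ?thesis by blast
    qed
  qed
  ultimately show ?thesis unfolding quasisimple_in_def by blast
qed

end

section \<open>Two subgroups without a common normal subgroup\<close>

text \<open>The group \<open>U\<close> of the introduction. For \<open>K\<close> normal in
  \<open>A\<close> this is the normal core of \<open>K \<inter> L\<close> in \<open>A\<close>; only
  membership in \<open>L\<close> has to be tested on conjugates.\<close>

definition (in group) core2 :: "'a set \<Rightarrow> 'a set \<Rightarrow> 'a set \<Rightarrow> 'a set" where
  "core2 A K L = {k \<in> K. \<forall>a\<in>A. a \<otimes> k \<otimes> inv a \<in> L}"

text \<open>For vertex stabilisers this is the union of the
  \<open>O\<^sub>p(G\<^sub>x\<^sub>,\<^sub>w)\<close> over the neighbours \<open>w\<close> of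
  \<open>x\<close>, since \<open>A\<close> permutes these neighbours transitively.\<close>

definition (in group) core_conjs :: "nat \<Rightarrow> 'a set \<Rightarrow> 'a set \<Rightarrow> 'a set" where
  "core_conjs p A H = (\<Union>a\<in>A. conj_by a (Op p H))"

locale amalgam = group +
  fixes A B K L
  assumes fin: "finite (carrier G)"
    and A: "subgroup A G" and B: "subgroup B G"
    and K: "K \<lhd> G\<lparr>carrier := A\<rparr>" "K \<subseteq> B" and L: "L \<lhd> G\<lparr>carrier := B\<rparr>" "L \<subseteq> A"
    and faithful: "\<And>N. N \<lhd> G\<lparr>carrier := A\<rparr> \<Longrightarrow> N \<lhd> G\<lparr>carrier := B\<rparr> \<Longrightarrow> N = {\<one>}"
begin

text \<open>The setting is symmetric. Every later lemma is stated at the end of \<open>A\<close>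
  only and is read at the end of \<open>B\<close> through this interpretation.\<close>

lemma swap: "amalgam G B A L K"
proof (intro amalgam.intro amalgam_axioms.intro)
  show "N = {\<one>}" if "N \<lhd> G\<lparr>carrier := B\<rparr>" "N \<lhd> G\<lparr>carrier := A\<rparr>" for N
    using faithful that by blast
qed (rule group_axioms fin A B K L)+

sublocale A: subgroup A G by (rule A)
sublocale B: subgroup B G by (rule B)

abbreviation "H \<equiv> A \<inter> B"

lemma H: "subgroup H G"
  using A B by (rule subgroups_Inter_pair)

lemmas K_facts = normal_in_iff[THEN iffD1, OF A K(1)]
lemmas L_facts = normal_in_iff[THEN iffD1, OF B L(1)]

lemma K_normal: "K \<lhd> G\<lparr>carrier := H\<rparr>"
  using K_facts K(2) by (auto simp: normal_in_iff[OF H])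

lemma K_sub: "subgroup K G" and L_sub: "subgroup L G"
  using K_facts L_facts by blast+

lemma K_le: "K \<subseteq> H"
  using K_facts K(2) by blast

lemma KL_normal: "K \<inter> L \<lhd> G\<lparr>carrier := H\<rparr>"
  using K_facts L_facts K(2) L(2) subgroups_Inter_pair by (auto simp: normal_in_iff[OF H])

text \<open>Both factors of \<open>A = X H\<close> normalise \<open>N\<close>.\<close>

lemma normal_if_factorises:
  assumes N: "N \<lhd> G\<lparr>carrier := H\<rparr>" and X: "A \<subseteq> X <#> H" "X \<subseteq> A"
    and XN: "\<And>x n. x \<in> X \<Longrightarrow> n \<in> N \<Longrightarrow> x \<otimes> n \<otimes> inv x \<in> N"
  shows "N \<lhd> G\<lparr>carrier := A\<rparr>"
proof -
  note N = normal_in_iff[THEN iffD1, OF H N]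
  have "a \<otimes> n \<otimes> inv a \<in> N" if a: "a \<in> A" and n: "n \<in> N" for a n
  proof -
    obtain x h where xh: "x \<in> X" "h \<in> H" "a = x \<otimes> h"
      using a X(1) by (auto simp: set_mult_def)
    have c: "x \<in> carrier G" "h \<in> carrier G" "n \<in> carrier G"
      using xh X(2) n N by (auto dest: subgroup.mem_carrier)
    have "x \<otimes> (h \<otimes> n \<otimes> inv h) \<otimes> inv x \<in> N"
      using XN xh n N by blast
    then show ?thesis using c by (simp add: xh(3) word_simps)
  qed
  then show ?thesis using N by (auto simp: normal_in_iff[OF A])
qed

section \<open>The largest normal subgroup of \<open>A\<close> inside
  \<open>K \<inter> L\<close>\<close>

lemma core2_normal: "core2 A K L \<lhd> G\<lparr>carrier := A\<rparr>"
proof -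
  interpret K: subgroup K G by (rule K_sub)
  interpret L: subgroup L G by (rule L_sub)
  have "subgroup (core2 A K L) G"
  proof (rule subgroupI)
    have "\<one> \<in> core2 A K L" by (simp add: core2_def)
    then show "core2 A K L \<noteq> {}" by blast
    fix x assume x: "x \<in> core2 A K L"
    then have xc: "x \<in> carrier G" by (simp add: core2_def)
    have "a \<otimes> inv x \<otimes> inv a = inv (a \<otimes> x \<otimes> inv a)" if "a \<in> A" for a
      using that xc by (simp add: word_simps)
    then show "inv x \<in> core2 A K L" using x by (simp add: core2_def)
    fix y assume y: "y \<in> core2 A K L"
    then have yc: "y \<in> carrier G" by (simp add: core2_def)
    have "a \<otimes> (x \<otimes> y) \<otimes> inv a = (a \<otimes> x \<otimes> inv a) \<otimes> (a \<otimes> y \<otimes> inv a)" if "a \<in> A" for a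
      using that xc yc by (simp add: word_simps)
    then show "x \<otimes> y \<in> core2 A K L" using x y by (simp add: core2_def)
  qed (auto simp: core2_def)
  moreover have "a \<otimes> k \<otimes> inv a \<in> core2 A K L" if a: "a \<in> A" and k: "k \<in> core2 A K L" for a k
  proof -
    have "b \<otimes> (a \<otimes> k \<otimes> inv a) \<otimes> inv b = (b \<otimes> a) \<otimes> k \<otimes> inv (b \<otimes> a)" if "b \<in> A" for b
      using that a k by (simp add: word_simps core2_def)
    then show ?thesis using a k K_facts by (simp add: core2_def)
  qed
  moreover have "core2 A K L \<subseteq> A" using K_facts by (auto simp: core2_def)
  ultimately show ?thesis by (simp add: normal_in_iff[OF A])
qed

lemma core2_le: "core2 A K L \<subseteq> K \<inter> L"
proof
  fix k assume k: "k \<in> core2 A K L"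
  then have "k \<in> K" "\<one> \<otimes> k \<otimes> inv \<one> \<in> L" using A.one_closed unfolding core2_def by blast+
  then show "k \<in> K \<inter> L" using subgroup.mem_carrier[OF K_sub] by simp
qed

lemma le_core2: "N \<lhd> G\<lparr>carrier := A\<rparr> \<Longrightarrow> N \<subseteq> K \<Longrightarrow> N \<subseteq> L \<Longrightarrow> N \<subseteq> core2 A K L"
  by (auto simp: normal_in_iff[OF A] core2_def)

lemma core2_normal_H: "core2 A K L \<lhd> G\<lparr>carrier := H\<rparr>"
  using core2_normal core2_le K(2) by (auto simp: normal_in_iff[OF A] normal_in_iff[OF H])

lemma KL_eq_core2_if_normal: "K \<inter> L \<lhd> G\<lparr>carrier := A\<rparr> \<Longrightarrow> K \<inter> L = core2 A K L"
  using le_core2 core2_le by blast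

section \<open>The case of a transitive centraliser\<close>

definition "C = {c \<in> A. \<forall>k\<in>K. c \<otimes> k = k \<otimes> c}"

lemma centraliser_transitive_normal:
  assumes tr: "A \<subseteq> C <#> H" and N: "N \<lhd> G\<lparr>carrier := H\<rparr>" "N \<subseteq> K"
  shows "N \<lhd> G\<lparr>carrier := A\<rparr>"
proof (rule normal_if_factorises[OF N(1) tr])
  show "C \<subseteq> A" by (auto simp: C_def)
  fix c n assume c: "c \<in> C" and n: "n \<in> N"
  have cc: "c \<in> carrier G" "n \<in> carrier G"
    using c n N(2) subgroup.mem_carrier[OF K_sub] by (auto simp: C_def)
  have "c \<otimes> n = n \<otimes> c" using c n N(2) by (auto simp: C_def)
  then have "c \<otimes> n \<otimes> inv c = n" using cc by (simp add: m_assoc)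
  then show "c \<otimes> n \<otimes> inv c \<in> N" using n by simp
qed

text \<open>\<open>centraliser_transitive_normal\<close> applies both to \<open>K \<inter> L\<close>
  and to \<open>core2 B L K\<close>. The latter is normal in \<open>B\<close> as well, hence
  trivial.\<close>

lemma centraliser_transitive:
  assumes tr: "A \<subseteq> C <#> H"
  shows "K \<inter> L = core2 A K L" "core2 B L K = {\<one>}"
proof -
  show "K \<inter> L = core2 A K L"
    using centraliser_transitive_normal[OF tr KL_normal] KL_eq_core2_if_normal by blast
  interpret s: amalgam G B A L K by (rule swap)
  have "core2 B L K \<lhd> G\<lparr>carrier := H\<rparr>" "core2 B L K \<subseteq> K"
    using s.core2_normal_H s.core2_le by (auto simp: Int_commute)
  then have "core2 B L K \<lhd> G\<lparr>carrier := A\<rparr>"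
    using centraliser_transitive_normal[OF tr] by blast
  then show "core2 B L K = {\<one>}"
    using faithful s.core2_normal by blast
qed

section \<open>Transitivity of the group generated by the conjugates of
  \<open>O\<^sub>p(H)\<close>\<close>

text \<open>\<open>Op p H\<close> is normal in \<open>K\<close>, hence inside \<open>Op p K\<close>;
  the reverse inclusion holds as \<open>K\<close> is normal in \<open>H\<close>. Normality in
  \<open>A\<close> is then that of \<open>Op p K\<close>.\<close>

lemma p_core_normal_if_le:
  assumes p: "prime p" and le: "Op p H \<subseteq> K"
  shows "Op p H \<lhd> G\<lparr>carrier := A\<rparr>"
proof -
  note P = p_core_in_subgroup[OF fin p H]
  have "Op p H \<lhd> G\<lparr>carrier := K\<rparr>"
    unfolding normal_in_iff[OF K_sub] using P le K_le by blast
  then have "Op p H \<subseteq> Op p K"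
    using p_core_in(3)[OF fin p K_sub] p_core_in(2)[OF fin p H] by blast
  moreover have "Op p K \<subseteq> Op p H"
    using fin p H K_normal by (rule p_core_mono)
  ultimately have "Op p H = Op p K" by blast
  then show ?thesis using p_core_normal[OF fin p A K(1)] by simp
qed

text \<open>Transitivity on the neighbours, expressed as a factorisation of \<open>A\<close>: the
  point stabiliser in this action is \<open>H\<close>.\<close>

definition "trans_at p \<longleftrightarrow> A \<subseteq> generate G (core_conjs p A H) <#> H"

lemma core_conjs_le: "prime p \<Longrightarrow> core_conjs p A H \<subseteq> A"
  using p_core_in_subgroup(2)[OF fin _ H] by (auto simp: core_conjs_def)

text \<open>By \<open>normal_if_factorises\<close> it suffices that the generated subgroup
  normalises \<open>N\<close>, and this is checked on the generators.\<close>

lemma trans_at_normal: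
  assumes p: "prime p" and tr: "trans_at p" and N: "N \<lhd> G\<lparr>carrier := H\<rparr>"
    and cl: "\<And>a u n. a \<in> A \<Longrightarrow> u \<in> Op p H \<Longrightarrow> n \<in> N \<Longrightarrow> (a \<otimes> u \<otimes> inv a) \<otimes> n \<otimes> inv (a \<otimes> u \<otimes> inv a) \<in> N"
  shows "N \<lhd> G\<lparr>carrier := A\<rparr>"
proof (rule normal_if_factorises[OF N tr[unfolded trans_at_def]])
  note le = core_conjs_le[OF p]
  note P = p_core_in_subgroup[OF fin p H]
  note N = normal_in_iff[THEN iffD1, OF H N]
  show leA: "generate G (core_conjs p A H) \<subseteq> A"
    using le A by (rule generate_subgroup_incl)
  fix x assume "x \<in> generate G (core_conjs p A H)"
  then have "\<forall>n\<in>N. x \<otimes> n \<otimes> inv x \<in> N"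
  proof (induction rule: generate.induct)
    case one
    then show ?case using subgroup.mem_carrier[OF conjunct1[OF N]] by simp
  next
    case (incl h)
    then show ?case using cl by (auto simp: core_conjs_def)
  next
    case (inv h)
    then obtain a u where au: "a \<in> A" "u \<in> Op p H" "h = a \<otimes> u \<otimes> inv a"
      by (auto simp: core_conjs_def)
    have "u \<in> carrier G" using P(1) au(2) by (rule subgroup.mem_carrier)
    then have "inv h = a \<otimes> inv u \<otimes> inv a" using au by (simp add: word_simps)
    moreover have "inv u \<in> Op p H" using P(1) au(2) by (rule subgroup.m_inv_closed)
    ultimately show ?case using cl[OF au(1)] by simp
  next
    case (eng x y)
    have c: "x \<in> carrier G" "y \<in> carrier G" using eng leA by auto
    show ?case
    proof
      fix n assume n: "n \<in> N"
      then have nc: "n \<in> carrier G" using subgroup.mem_carrier[OF conjunct1[OF N]] by blast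
      have "x \<otimes> (y \<otimes> n \<otimes> inv y) \<otimes> inv x \<in> N" using eng n by blast
      then show "x \<otimes> y \<otimes> n \<otimes> inv (x \<otimes> y) \<in> N" using c nc by (simp add: word_simps)
    qed
  qed
  then show "x \<otimes> n \<otimes> inv x \<in> N" if "n \<in> N" for n using that by blast
qed

text \<open>A conjugate \<open>a u a^-1\<close> must preserve \<open>O\<^sup>p(S)\<close>.
  Conjugating back, \<open>u\<close> has to act on the conjugate of \<open>S\<close> by
  \<open>a^-1\<close>, which is again normal in \<open>K\<close> because \<open>K\<close> is normal
  in \<open>A\<close>. There \<open>coprime_conj_mem\<close> applies.\<close>

lemma p_residual_normal_A:
  assumes p: "prime p" and tr: "trans_at p" and S: "S \<lhd> G\<lparr>carrier := H\<rparr>" "S \<subseteq> K"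
  shows "p_residual p S \<lhd> G\<lparr>carrier := A\<rparr>"
proof (rule trans_at_normal[OF p tr])
  show "p_residual p S \<lhd> G\<lparr>carrier := H\<rparr>"
    using H S(1) by (rule p_residual_normal)
  note S' = normal_in_iff[THEN iffD1, OF H S(1)]
  have sS: "subgroup S G" using S' by blast
  note P = p_core_in_subgroup[OF fin p H]
  have SK: "S \<lhd> G\<lparr>carrier := K\<rparr>"
    using S' S(2) K_facts K(2) by (auto simp: normal_in_iff[OF K_sub])
  fix a u n assume a: "a \<in> A" and u: "u \<in> Op p H" and n: "n \<in> p_residual p S"
  have [simp]: "a \<in> carrier G" "u \<in> carrier G"
    using a P(1) u subgroup.mem_carrier by auto
  show "(a \<otimes> u \<otimes> inv a) \<otimes> n \<otimes> inv (a \<otimes> u \<otimes> inv a) \<in> p_residual p S"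
  proof (rule p_residual_conj[OF sS _ _ n])
    fix g m assume g: "g \<in> S" "coprime (m::nat) p" "g [^] m = \<one>"
    have [simp]: "g \<in> carrier G" using sS g(1) by (rule subgroup.mem_carrier)
    let ?S = "conj_by (inv a) S"
    have "?S \<lhd> G\<lparr>carrier := conj_by (inv a) K\<rparr>"
      using K_sub SK by (rule normal_conj_by) simp
    then have "?S \<lhd> G\<lparr>carrier := K\<rparr>"
      using normal_conj_by_eq[OF A K(1), of "inv a"] a by simp
    then have "u \<otimes> (inv a \<otimes> g \<otimes> inv (inv a)) \<otimes> inv u \<in> ?S"
      using g conj_pow[of "inv a" g m]
      by (intro coprime_conj_mem[OF H K_normal _ p_core_in(1,2)[OF fin p H] _ _ g(2) u]) auto
    then have "a \<otimes> (u \<otimes> (inv a \<otimes> g \<otimes> inv (inv a)) \<otimes> inv u) \<otimes> inv a \<in> conj_by a ?S"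
      by blast
    then show "(a \<otimes> u \<otimes> inv a) \<otimes> g \<otimes> inv (a \<otimes> u \<otimes> inv a) \<in> S"
      using conj_by_inv(2)[OF subgroup.subset[OF sS], of a] by (simp add: word_simps)
  qed simp
qed

lemma p_residual_KL_le: "prime p \<Longrightarrow> trans_at p \<Longrightarrow> p_residual p (K \<inter> L) \<subseteq> core2 A K L"
  using p_residual_normal_A[OF _ _ KL_normal] p_residual_subgroup(2)[OF subgroups_Inter_pair[OF K_sub L_sub]]
  by (intro le_core2) blast+

lemma other_core2:
  shows "subgroup (core2 B L K) G" "core2 B L K \<lhd> G\<lparr>carrier := H\<rparr>" "core2 B L K \<subseteq> K"
    "core2 B L K \<lhd> G\<lparr>carrier := B\<rparr>"
proof -
  interpret s: amalgam G B A L K by (rule swap)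
  show "core2 B L K \<lhd> G\<lparr>carrier := H\<rparr>" "core2 B L K \<subseteq> K" "core2 B L K \<lhd> G\<lparr>carrier := B\<rparr>"
    using s.core2_normal_H s.core2_le s.core2_normal by (auto simp: Int_commute)
  then show "subgroup (core2 B L K) G" by (simp add: normal_in_iff[OF B])
qed

lemma finite_subset_carrier: "subgroup S G \<Longrightarrow> finite S"
  using fin finite_subset subgroup.subset by blast

text \<open>The residual is normal in \<open>A\<close> by transitivity and in \<open>B\<close>
  because \<open>core2 B L K\<close> is.\<close>

lemma p_residual_other_core2:
  assumes "prime p" "trans_at p"
  shows "p_residual p (core2 B L K) = {\<one>}"
  using faithful p_residual_normal_A[OF assms other_core2(2,3)] p_residual_normal[OF B other_core2(4)]
  by blast

lemma p_group_other_core2: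
  assumes "prime p" "trans_at p"
  shows "p_group p (G\<lparr>carrier := core2 B L K\<rparr>)"
  using p_group_if_p_residual_trivial[OF other_core2(1) finite_subset_carrier[OF other_core2(1)] assms(1)]
    p_residual_other_core2[OF assms] by blast

text \<open>Any group here is generated by its residuals for two distinct primes. For
  \<open>K \<inter> L\<close> both lie in \<open>core2 A K L\<close>; for \<open>core2 B L K\<close>
  both are trivial.\<close>

lemma two_primes_trans_at:
  assumes "prime p" "prime q" "p \<noteq> q" "trans_at p" "trans_at q"
  shows "K \<inter> L = core2 A K L" "core2 B L K = {\<one>}"
proof -
  have KL: "subgroup (K \<inter> L) G" using K_sub L_sub by (rule subgroups_Inter_pair)
  have "subgroup (core2 A K L) G" using core2_normal by (simp add: normal_in_iff[OF A])
  then show "K \<inter> L = core2 A K L"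
    using p_residuals_generate[OF KL finite_subset_carrier[OF KL] assms(1-3)] p_residual_KL_le assms core2_le
    by blast
  have "core2 B L K \<subseteq> {\<one>}"
    using other_core2(1) finite_subset_carrier[OF other_core2(1)] assms(1-3) triv_subgroup
    by (rule p_residuals_generate) (simp_all add: p_residual_other_core2 assms)
  then show "core2 B L K = {\<one>}"
    using subgroup.one_closed[OF other_core2(1)] by blast
qed

text \<open>Since \<open>K\<close> and \<open>P = O\<^sub>p(H)\<close> are normal in \<open>H\<close>, \<open>[K, P] \<le> K \<inter> P = O\<^sub>p(K)\<close>, which is normal in \<open>A\<close>
  and contained in \<open>K \<inter> L\<close>; hence \<open>[K, P\<^sup>a] \<le> K \<inter> L\<close> for all \<open>a\<close> in \<open>A\<close>.\<close>

lemma KL_eq_core2_if_trans_at_one: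
  assumes p: "prime p" and tr: "trans_at p" and le: "Op p H \<subseteq> L"
  shows "K \<inter> L = core2 A K L"
proof (rule KL_eq_core2_if_normal, rule trans_at_normal[OF p tr KL_normal])
  note P = p_core_in_subgroup[OF fin p H]
  note O = p_core_in_subgroup[OF fin p K_sub]
  have KP: "K \<inter> Op p H \<subseteq> Op p K"
  proof -
    have sKP: "subgroup (K \<inter> Op p H) G" using K_sub P(1) by (rule subgroups_Inter_pair)
    have "K \<inter> Op p H \<lhd> G\<lparr>carrier := K\<rparr>"
      using sKP P(3) K_facts K(2) by (auto simp: normal_in_iff[OF K_sub])
    moreover have "p_group p (G\<lparr>carrier := K \<inter> Op p H\<rparr>)"
      using p_group_subgroup[OF P(1) p_core_in(2)[OF fin p H] sKP _ p] by blast
    ultimately show ?thesis using p_core_in(3)[OF fin p K_sub] by blast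
  qed
  have OL: "Op p K \<subseteq> L" using p_core_mono[OF fin p H K_normal] le by blast
  have OA: "a \<otimes> v \<otimes> inv a \<in> Op p K" if "a \<in> A" "v \<in> Op p K" for a v
    using p_core_normal[OF fin p A K(1)] that by (simp add: normal_in_iff[OF A])
  fix a u n assume a: "a \<in> A" and u: "u \<in> Op p H" and n: "n \<in> K \<inter> L"
  have [simp]: "a \<in> carrier G" "u \<in> carrier G" "n \<in> carrier G"
    using a P(1) u n K_sub subgroup.mem_carrier by auto
  interpret K: subgroup K G by (rule K_sub)
  interpret L: subgroup L G by (rule L_sub)
  interpret P: subgroup "Op p H" G by (rule P(1))
  \<comment> \<open>The commutator of \<open>u\<close> is formed with \<open>k\<close>, the
    conjugate of \<open>n\<close> back by \<open>a\<close>, which is in \<open>K\<close> though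
    perhaps not in \<open>L\<close>.\<close>
  define k where "k = inv a \<otimes> n \<otimes> a"
  have "inv a \<otimes> n \<otimes> inv (inv a) \<in> K" using K_facts a n A.m_inv_closed by blast
  then have k: "k \<in> K" by (simp add: k_def)
  have "u \<in> H" using u P(2) by blast
  then have "u \<otimes> k \<otimes> inv u \<in> K" using K_facts k by blast
  then have "(u \<otimes> k \<otimes> inv u) \<otimes> inv k \<in> K" using k by blast
  moreover have "k \<otimes> inv u \<otimes> inv k \<in> Op p H"
    using P(3) u k K_facts K(2) by blast
  then have "u \<otimes> (k \<otimes> inv u \<otimes> inv k) \<in> Op p H" using u by blast
  then have "(u \<otimes> k \<otimes> inv u) \<otimes> inv k \<in> Op p H" using k by (simp add: m_assoc)
  ultimately have "a \<otimes> ((u \<otimes> k \<otimes> inv u) \<otimes> inv k) \<otimes> inv a \<in> Op p K"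
    using KP OA a by blast
  \<comment> \<open>Carried forward by \<open>a\<close> and multiplied by \<open>n\<close>, the
    commutator becomes the conjugate of \<open>n\<close> by \<open>a u a^-1\<close>.\<close>
  then have "(a \<otimes> ((u \<otimes> k \<otimes> inv u) \<otimes> inv k) \<otimes> inv a) \<otimes> n \<in> K \<inter> L"
    using OL O(2) n by (meson IntD1 IntD2 IntI K.m_closed L.m_closed subsetD)
  then show "(a \<otimes> u \<otimes> inv a) \<otimes> n \<otimes> inv (a \<otimes> u \<otimes> inv a) \<in> K \<inter> L"
    by (simp add: k_def word_simps)
qed

section \<open>Components of \<open>H\<close> when centralisers are semiregular\<close>

definition "comps = {X. subnormal (G\<lparr>carrier := H\<rparr>) X \<and> quasisimple_in X}"

text \<open>A component outside \<open>K\<close> would centralise \<open>K\<close> and so lie in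
  \<open>C \<inter> B\<close>, which is inside \<open>K\<close>.\<close>

lemma comps_le:
  assumes sr: "C \<inter> B \<subseteq> K" and X: "X \<in> comps"
  shows "X \<subseteq> K"
proof -
  have "X \<subseteq> K \<or> (\<forall>x\<in>X. \<forall>k\<in>K. x \<otimes> k = k \<otimes> x)"
    using component_in_normal_or_commutes[OF H _ _ K_normal] X by (auto simp: comps_def)
  moreover have "X \<subseteq> A \<inter> B"
    using subnormal_subgroup_in[OF H, of X] X by (simp add: comps_def)
  ultimately show ?thesis
    using sr unfolding C_def by blast
qed

text \<open>An element of \<open>A\<close> may fail to normalise \<open>H\<close> but does normalise
  \<open>K\<close>. As \<open>X\<close> lies in \<open>K\<close>, its conjugate is subnormal in
  \<open>K\<close> and thus in \<open>H\<close>.\<close>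

lemma conj_by_comps:
  assumes sr: "C \<inter> B \<subseteq> K" and X: "X \<in> comps" and a: "a \<in> A"
  shows "conj_by a X \<in> comps"
proof -
  have XK: "X \<subseteq> K" using sr X by (rule comps_le)
  have sub: "subgroup X G" using subnormal_subgroup_in[OF H, of X] X by (auto simp: comps_def)
  have ac: "a \<in> carrier G" using a by simp
  have "subnormal (G\<lparr>carrier := K\<rparr>) (X \<inter> K)"
    using subnormal_restrict[OF H K_sub, of X] X K_facts K(2) by (auto simp: comps_def)
  then have "subnormal (G\<lparr>carrier := K\<rparr>) (conj_by a X)"
    using subnormal_conj_by[OF K_sub ac normal_conj_by_eq[OF A K(1) a]] XK by (simp add: Int_absorb2)
  moreover have "subnormal (G\<lparr>carrier := H\<rparr>) K"
    using subnormal.step[OF subnormal.whole[of "G\<lparr>carrier := H\<rparr>"], of K] K_normal by simp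
  ultimately have "subnormal (G\<lparr>carrier := H\<rparr>) (conj_by a X)"
    using group.subnormal_trans[OF subgroup_imp_group[OF H], of K] by simp
  then show ?thesis
    using quasisimple_in_conj_by[OF sub _ ac] X by (simp add: comps_def)
qed

lemma generate_comps_normal:
  assumes sr: "C \<inter> B \<subseteq> K"
  shows "generate G (\<Union>comps) \<lhd> G\<lparr>carrier := A\<rparr>"
proof -
  have le: "\<Union>comps \<subseteq> A" using comps_le[OF sr] K_facts by blast
  then have lec: "\<Union>comps \<subseteq> carrier G" using A.subset by blast
  have "a \<otimes> x \<otimes> inv a \<in> generate G (\<Union>comps)" if "a \<in> A" "x \<in> generate G (\<Union>comps)" for a x
  proof (rule generate_conj_closed[OF lec _ _ that(2)])
    fix t assume "t \<in> \<Union>comps"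
    then obtain X where "X \<in> comps" "t \<in> X" by blast
    then show "a \<otimes> t \<otimes> inv a \<in> generate G (\<Union>comps)"
      using conj_by_comps[OF sr _ that(1)] by (intro generate.incl) blast
  qed (use that in simp)
  then show ?thesis
    using generate_is_subgroup[OF lec] generate_subgroup_incl[OF le A] by (auto simp: normal_in_iff[OF A])
qed

end

context amalgam
begin

text \<open>\<open>comps\<close> depends only on \<open>H\<close>, so the subgroup it generates is
  normal in \<open>A\<close> and, by symmetry, in \<open>B\<close>.\<close>

lemma no_components:
  assumes sA: "C \<inter> B \<subseteq> K" and sB: "amalgam.C G B L \<inter> A \<subseteq> L"
    and X: "subnormal (G\<lparr>carrier := H\<rparr>) X"
  shows "\<not> quasisimple (G\<lparr>carrier := X\<rparr>)"
proof
  assume q: "quasisimple (G\<lparr>carrier := X\<rparr>)"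
  interpret s: amalgam G B A L K by (rule swap)
  have sub: "subgroup X G" using subnormal_subgroup_in[OF H X] by blast
  have comp: "X \<in> comps"
    using X quasisimple_in_if_quasisimple[OF sub q] by (simp add: comps_def)
  have eq: "s.comps = comps" by (simp add: s.comps_def comps_def Int_commute)
  have "generate G (\<Union>comps) = {\<one>}"
    using generate_comps_normal[OF sA] s.generate_comps_normal[OF sB] faithful unfolding eq by blast
  then have "X \<subseteq> {\<one>}"
    using generate.incl[of _ "\<Union>comps" G] comp by blast
  then have "X = {\<one>}" using subgroup.one_closed[OF sub] by blast
  then show False using comp by (simp add: comps_def quasisimple_in_def)
qed

section \<open>Combination of the cases\<close>

lemma p_group_trivial: "p_group p (G\<lparr>carrier := {\<one>}\<rparr>)"
  by (simp add: p_group_iff[OF triv_subgroup] exI[of _ 0])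

text \<open>Part (1) of the theorem in group terms. The equality of the balls of radius 2 and 3 is
  left to \<open>ball_2_eq_ball_3\<close>, which derives it from the equation for
  \<open>K \<inter> L\<close>.\<close>

definition "conclusion1 p \<longleftrightarrow> p_group p (G\<lparr>carrier := K \<inter> L\<rparr>) \<or>
  (K \<inter> L = core2 A K L \<and> p_group p (G\<lparr>carrier := core2 B L K\<rparr>)) \<or>
  (K \<inter> L = core2 B L K \<and> p_group p (G\<lparr>carrier := core2 A K L\<rparr>))"

definition "conclusion2 p \<longleftrightarrow> p_group p (G\<lparr>carrier := generalised_fitting (G\<lparr>carrier := H\<rparr>)\<rparr>) \<or>
  (K \<inter> L = core2 A K L \<and> core2 B L K = {\<one>}) \<or> (K \<inter> L = core2 B L K \<and> core2 A K L = {\<one>})"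

text \<open>A transitive centraliser at one end gives the second alternative of (2). Otherwise
  \<open>H\<close> has no components, and the cases are whether no, exactly one or more than one
  prime has a nontrivial \<open>O\<^sub>p(H)\<close>.\<close>

theorem local_alternative:
  assumes A1: "A \<subseteq> C <#> H \<or> C \<inter> B \<subseteq> K"
    and B1: "B \<subseteq> amalgam.C G B L <#> H \<or> amalgam.C G B L \<inter> A \<subseteq> L"
    and A2: "\<And>q. prime q \<Longrightarrow> trans_at q \<or> Op q H \<subseteq> K"
    and B2: "\<And>q. prime q \<Longrightarrow> amalgam.trans_at G B A q \<or> Op q H \<subseteq> L"
  shows "\<exists>p. prime p \<and> conclusion1 p \<and> conclusion2 p"
proof -
  interpret s: amalgam G B A L K by (rule swap)
  have comm: "B \<inter> A = A \<inter> B" "L \<inter> K = K \<inter> L" by blast+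
  have KL_sub: "subgroup (K \<inter> L) G" using K_sub L_sub by (rule subgroups_Inter_pair)
  \<comment> \<open>The second alternative of (2) implies that of (1) for every prime, the trivial
    group being a \<open>p\<close>-group; the prime 2 is an arbitrary choice.\<close>
  have strong: "\<exists>p. prime p \<and> conclusion1 p \<and> conclusion2 p"
    if "(K \<inter> L = core2 A K L \<and> core2 B L K = {\<one>}) \<or> (K \<inter> L = core2 B L K \<and> core2 A K L = {\<one>})"
    using that two_is_prime_nat p_group_trivial unfolding conclusion1_def conclusion2_def by metis
  show ?thesis
  proof (cases "A \<subseteq> C <#> H \<or> B \<subseteq> s.C <#> H")
    case True
    then show ?thesis
      using strong centraliser_transitive s.centraliser_transitive unfolding comm by blast
  next
    case False
    then have no_comp: "\<not> quasisimple (G\<lparr>carrier := X\<rparr>)" if "subnormal (G\<lparr>carrier := H\<rparr>) X" for X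
      using no_components A1 B1 that by blast
    interpret H: group "G\<lparr>carrier := H\<rparr>" using H by (rule subgroup_imp_group)
    have finH: "finite H" using H by (rule finite_subset_carrier)
    have gf: "p_group p (G\<lparr>carrier := generalised_fitting (G\<lparr>carrier := H\<rparr>)\<rparr>)"
      if "prime p" "\<And>q. prime q \<Longrightarrow> q \<noteq> p \<Longrightarrow> Op q H = {\<one>}" for p
      using H.p_group_generalised_fitting[of p] that no_comp finH by simp
    \<comment> \<open>If transitivity failed at both ends, \<open>Op p H\<close> would lie in
      \<open>K\<close> and in \<open>L\<close>, hence be normal in \<open>A\<close> and in
      \<open>B\<close>.\<close>
    have trans: "trans_at p \<or> s.trans_at p" if "prime p" "Op p H \<noteq> {\<one>}" for p
      using A2[OF that(1)] B2[OF that(1)] p_core_normal_if_le[OF that(1)] s.p_core_normal_if_le[OF that(1)]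
        faithful[of "Op p H"] that(2) unfolding comm by blast
    have one: "conclusion1 p" if p: "prime p" "Op p H \<noteq> {\<one>}" for p
    proof -
      consider "trans_at p" "s.trans_at p" | "trans_at p" "Op p H \<subseteq> L" | "s.trans_at p" "Op p H \<subseteq> K"
        using trans[OF p] A2[OF p(1)] B2[OF p(1)] by blast
      then show ?thesis
      proof cases
        case 1
        have "p_residual p (K \<inter> L) \<lhd> G\<lparr>carrier := A\<rparr>" "p_residual p (K \<inter> L) \<lhd> G\<lparr>carrier := B\<rparr>"
          using p_residual_normal_A[OF p(1) 1(1) KL_normal] s.p_residual_normal_A[OF p(1) 1(2) s.KL_normal]
          unfolding comm by blast+
        then have "p_residual p (K \<inter> L) = {\<one>}" by (rule faithful)
        then show ?thesis
          using p_group_if_p_residual_trivial[OF KL_sub finite_subset_carrier[OF KL_sub] p(1)]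
          by (simp add: conclusion1_def)
      next
        case 2
        then show ?thesis
          using KL_eq_core2_if_trans_at_one p_group_other_core2 p(1) by (simp add: conclusion1_def)
      next
        case 3
        then show ?thesis
          using s.KL_eq_core2_if_trans_at_one[OF p(1)] s.p_group_other_core2[OF p(1)]
          by (simp add: conclusion1_def comm)
      qed
    qed
    show ?thesis
    proof (cases "\<exists>p. prime p \<and> Op p H \<noteq> {\<one>}")
      case False
      \<comment> \<open>A nontrivial group without components would have a nontrivial
        \<open>O\<^sub>p\<close> for some prime.\<close>
      have "H = {\<one>}"
        using H.ex_p_core_or_component no_comp finH False by auto
      then have "K \<inter> L = {\<one>}"
        using K_le subgroup.one_closed[OF KL_sub] by blast
      then have "conclusion1 2" using p_group_trivial by (simp add: conclusion1_def)
      moreover have "conclusion2 2" using gf[of 2] False by (auto simp: conclusion2_def)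
      ultimately show ?thesis using two_is_prime_nat by blast
    next
      case True
      then obtain p where p: "prime p" "Op p H \<noteq> {\<one>}" by blast
      show ?thesis
      proof (cases "\<exists>q. prime q \<and> q \<noteq> p \<and> Op q H \<noteq> {\<one>}")
        case False
        then show ?thesis
          using gf[of p] one[OF p] p(1) by (auto simp: conclusion2_def)
      next
        case True
        then obtain q where q: "prime q" "q \<noteq> p" "Op q H \<noteq> {\<one>}" by blast
        \<comment> \<open>If no end is transitive for both primes, each prime succeeds at exactly
          one end, and its failure at the other gives the inclusion there by \<open>A2\<close> or
          \<open>B2\<close>.\<close>
        consider "trans_at p" "trans_at q" | "s.trans_at p" "s.trans_at q"
          | "trans_at p" "Op p H \<subseteq> L" "s.trans_at q" "Op q H \<subseteq> K"
          | "trans_at q" "Op q H \<subseteq> L" "s.trans_at p" "Op p H \<subseteq> K"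
          using trans p q A2 B2 by meson
        then show ?thesis
        proof cases
          case 1
          then show ?thesis using strong two_primes_trans_at p q by metis
        next
          case 2
          then show ?thesis using strong s.two_primes_trans_at p q unfolding comm by metis
        next
          case 3
          \<comment> \<open>Being equal to both cores, \<open>K \<inter> L\<close> is normal in
            \<open>A\<close> and \<open>B\<close>, hence trivial, and \<open>strong\<close>
            applies.\<close>
          then have "K \<inter> L = core2 A K L" "K \<inter> L = core2 B L K"
            using KL_eq_core2_if_trans_at_one[OF p(1)] s.KL_eq_core2_if_trans_at_one[OF q(1)]
            unfolding comm by blast+
          then show ?thesis
            using strong faithful[of "K \<inter> L"] core2_normal s.core2_normal by metis
        next
          case 4
          then have "K \<inter> L = core2 A K L" "K \<inter> L = core2 B L K"
            using KL_eq_core2_if_trans_at_one[OF q(1)] s.KL_eq_core2_if_trans_at_one[OF p(1)]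
            unfolding comm by blast+
          then show ?thesis
            using strong faithful[of "K \<inter> L"] core2_normal s.core2_normal by metis
        qed
      qed
    qed
  qed
qed

end

section \<open>Locally transitive graphs\<close>

locale locally_transitive = graph D for D :: "('a, 'b) pre_digraph" +
  fixes G :: "('a \<Rightarrow> 'a) set"
  assumes connected: "connected D"
    and subgroup_auto: "subgroup G (perm_group (verts D) (graph_auto D))"
    and locally_trans: "\<And>v w w'. \<lbrakk>v \<in> verts D; w \<in> neighbours D v; w' \<in> neighbours D v\<rbrakk>
      \<Longrightarrow> \<exists>g\<in>stab G v. g w = w'"
begin

abbreviation "M \<equiv> BijGroup (verts D)"
abbreviation "ball \<equiv> ball_stab D G"

sublocale M: group M by (rule group_BijGroup)

lemma G: "subgroup G M"
  using M.incl_subgroup[OF subgroup_graph_auto subgroup_auto] .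

sublocale G: subgroup G M by (rule G)

lemma finite_M: "finite (carrier M)"
proof -
  have "Bij (verts D) \<subseteq> verts D \<rightarrow>\<^sub>E verts D"
    unfolding PiE_def using Bij_imp_funcset Bij_imp_extensional by blast
  then have "carrier M \<subseteq> verts D \<rightarrow>\<^sub>E verts D"
    by (simp add: BijGroup_def)
  then show ?thesis
    by (rule finite_subset) (intro finite_PiE finite_verts)
qed

section \<open>The action on vertices and neighbours\<close>

lemma Bij: "g \<in> G \<Longrightarrow> g \<in> Bij (verts D)"
  using G.subset by (auto simp: BijGroup_def)

lemma act_in [simp]: "g \<in> G \<Longrightarrow> v \<in> verts D \<Longrightarrow> g v \<in> verts D"
  using Bij Bij_imp_funcset by blast

lemma act_mult [simp]: "g \<in> G \<Longrightarrow> h \<in> G \<Longrightarrow> v \<in> verts D \<Longrightarrow> (g \<otimes>\<^bsub>M\<^esub> h) v = g (h v)"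
  using Bij by (simp add: BijGroup_def compose_eq)

lemma act_one [simp]: "v \<in> verts D \<Longrightarrow> \<one>\<^bsub>M\<^esub> v = v"
  by (simp add: BijGroup_def)

lemma act_inv [simp]:
  assumes "g \<in> G" "v \<in> verts D"
  shows "(inv\<^bsub>M\<^esub> g) (g v) = v" "g ((inv\<^bsub>M\<^esub> g) v) = v"
proof -
  \<comment> \<open>\<open>act_mult\<close> is switched off so that the product collapses to the
    identity before it is applied to \<open>v\<close>.\<close>
  have "(inv\<^bsub>M\<^esub> g \<otimes>\<^bsub>M\<^esub> g) v = v" "(g \<otimes>\<^bsub>M\<^esub> inv\<^bsub>M\<^esub> g) v = v"
    using assms by (simp_all del: act_mult)
  then show "(inv\<^bsub>M\<^esub> g) (g v) = v" "g ((inv\<^bsub>M\<^esub> g) v) = v"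
    using assms act_mult G.m_inv_closed by metis+
qed

lemma act_adj: "g \<in> G \<Longrightarrow> u \<in> verts D \<Longrightarrow> v \<in> verts D \<Longrightarrow> g u \<rightarrow>\<^bsub>D\<^esub> g v \<longleftrightarrow> u \<rightarrow>\<^bsub>D\<^esub> v"
  using subgroup.subset[OF subgroup_auto] by (auto simp: graph_auto_def)

text \<open>Elements of \<open>Bij\<close> are extensional, so agreement on the vertices determines
  them.\<close>

lemma act_ext: "g \<in> G \<Longrightarrow> (\<And>v. v \<in> verts D \<Longrightarrow> g v = v) \<Longrightarrow> g = \<one>\<^bsub>M\<^esub>"
  using Bij by (auto simp: BijGroup_def Bij_def intro: extensionalityI[of _ "verts D"])

lemma neighbours_verts: "w \<in> neighbours D v \<Longrightarrow> w \<in> verts D" "w \<in> neighbours D v \<Longrightarrow> v \<in> verts D"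
  by (auto simp: neighbours_def adj_in_verts)

lemma neighbours_sym: "w \<in> neighbours D v \<longleftrightarrow> v \<in> neighbours D w"
  using sym_arcs by (auto simp: neighbours_def symmetric_def sym_def)

lemma neighbours_act:
  assumes "g \<in> G" "w \<in> neighbours D v"
  shows "g w \<in> neighbours D (g v)"
  using assms act_adj[of g v w] neighbours_verts[of w v] by (auto simp: neighbours_def)

lemma stabD: "g \<in> stab G v \<Longrightarrow> g \<in> G" "g \<in> stab G v \<Longrightarrow> g v = v"
  by (auto simp: stab_def)

lemma stab_subgroup:
  assumes v: "v \<in> verts D"
  shows "subgroup (stab G v) M"
proof (rule M.subgroupI)
  have "\<one>\<^bsub>M\<^esub> \<in> stab G v" using v by (simp add: stab_def)
  then show "stab G v \<noteq> {}" by blast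
  fix g assume "g \<in> stab G v"
  then have g: "g \<in> G" "g v = v" by (auto simp: stab_def)
  then have "(inv\<^bsub>M\<^esub> g) (g v) = v" using v by (intro act_inv)
  then show "inv\<^bsub>M\<^esub> g \<in> stab G v" using g by (simp add: stab_def)
  fix h assume "h \<in> stab G v"
  then show "g \<otimes>\<^bsub>M\<^esub> h \<in> stab G v" using g v by (simp add: stab_def)
qed (auto simp: stab_def)

lemma stab_conj:
  assumes "a \<in> G" "g \<in> stab G v" "v \<in> verts D"
  shows "a \<otimes>\<^bsub>M\<^esub> g \<otimes>\<^bsub>M\<^esub> inv\<^bsub>M\<^esub> a \<in> stab G (a v)"
  using assms by (simp add: stab_def)

section \<open>Distances and stabilisers of balls\<close>

lemma graph_dist_0: "v \<in> verts D \<Longrightarrow> graph_dist D v w \<le> ereal (real 0) \<longleftrightarrow> w = v"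
  unfolding graph_dist_le_iff by (auto simp: awalk_Nil_iff)

lemma graph_dist_Suc:
  assumes "v \<in> verts D"
  shows "graph_dist D v w \<le> ereal (real (Suc i)) \<longleftrightarrow>
    w = v \<or> (\<exists>u\<in>neighbours D v. graph_dist D u w \<le> ereal (real i))"
  unfolding graph_dist_le_iff
proof
  assume "\<exists>p. awalk v p w \<and> length p \<le> Suc i"
  then obtain p where p: "awalk v p w" "length p \<le> Suc i" by blast
  show "w = v \<or> (\<exists>u\<in>neighbours D v. \<exists>p. awalk u p w \<and> length p \<le> i)"
  proof (cases p)
    case Nil
    then show ?thesis using p by (simp add: awalk_Nil_iff)
  next
    case (Cons e q)
    then have "e \<in> arcs D" "v = tail D e" "awalk (head D e) q w"
      using p(1) by (auto simp: awalk_Cons_iff)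
    then have "head D e \<in> neighbours D v" "awalk (head D e) q w"
      by (auto simp: neighbours_def arcs_ends_def arc_to_ends_def)
    then show ?thesis using p(2) Cons by auto
  qed
next
  assume "w = v \<or> (\<exists>u\<in>neighbours D v. \<exists>p. awalk u p w \<and> length p \<le> i)"
  then show "\<exists>p. awalk v p w \<and> length p \<le> Suc i"
  proof
    assume "w = v"
    then have "awalk v [] w" using assms by (simp add: awalk_Nil_iff)
    then show ?thesis by fastforce
  next
    assume "\<exists>u\<in>neighbours D v. \<exists>p. awalk u p w \<and> length p \<le> i"
    then obtain u p where up: "u \<in> neighbours D v" "awalk u p w" "length p \<le> i" by blast
    then obtain e where "e \<in> arcs D" "v = tail D e" "u = head D e"
      by (auto simp: neighbours_def arcs_ends_def arc_to_ends_def)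
    then have "awalk v (e # p) w" using up(2) by (simp add: awalk_Cons_iff)
    then show ?thesis using up(3) by (metis Suc_le_mono length_Cons)
  qed
qed

lemma ball_0: "v \<in> verts D \<Longrightarrow> ball 0 v = stab G v"
  using graph_dist_0 by (auto simp: ball_stab_def stab_def)

text \<open>A ball around \<open>v\<close> consists of \<open>v\<close> and the balls of radius one
  less around its neighbours. This recursion replaces walks in all later arguments about
  distance.\<close>

lemma ball_Suc:
  assumes v: "v \<in> verts D"
  shows "ball (Suc i) v = {g \<in> stab G v. \<forall>u\<in>neighbours D v. g \<in> ball i u}"
proof -
  have 1: "graph_dist D u u \<le> ereal (real i)" if "u \<in> verts D" for u
    unfolding graph_dist_le_iff using that by (auto intro!: exI[of _ "[]"] simp: awalk_Nil_iff)
  show ?thesis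
  proof (intro equalityI subsetI CollectI conjI ballI)
    fix g assume g: "g \<in> ball (Suc i) v"
    then show "g \<in> stab G v" by (simp add: ball_stab_def)
    fix u assume u: "u \<in> neighbours D v"
    then have "g w = w" if "w \<in> verts D" "graph_dist D u w \<le> ereal (real i)" for w
      using g that graph_dist_Suc[OF v] unfolding ball_stab_def by blast
    then show "g \<in> ball i u"
      using g 1 neighbours_verts(1)[OF u] by (simp add: ball_stab_def stab_def)
  next
    fix g assume g: "g \<in> {g \<in> stab G v. \<forall>u\<in>neighbours D v. g \<in> ball i u}"
    then have "g w = w" if "w \<in> verts D" "graph_dist D v w \<le> ereal (real (Suc i))" for w
      using that unfolding graph_dist_Suc[OF v] by (auto simp: ball_stab_def stab_def)
    then show "g \<in> ball (Suc i) v"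
      using g unfolding ball_stab_def by blast
  qed
qed

lemma ball_le_stab: "ball i v \<subseteq> stab G v"
  by (auto simp: ball_stab_def)

lemma ball_1: "v \<in> verts D \<Longrightarrow> ball 1 v = {g \<in> stab G v. \<forall>u\<in>neighbours D v. g u = u}"
  using ball_Suc[of v 0] ball_0 neighbours_verts(1)[of _ v] by (auto simp: stab_def)

lemmas ball_Suc_0 = ball_1[unfolded One_nat_def]

lemma ball_antimono:
  assumes "i \<le> j"
  shows "ball j v \<subseteq> ball i v"
proof -
  have "ereal (real i) \<le> ereal (real j)" using assms by simp
  then show ?thesis unfolding ball_stab_def using order_trans by blast
qed

text \<open>Induction on the radius: a neighbour of \<open>a v\<close> is pulled back to a neighbour
  of \<open>v\<close> by the inverse of \<open>a\<close>.\<close>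

lemma ball_conj:
  assumes "a \<in> G" "v \<in> verts D" "g \<in> ball i v"
  shows "a \<otimes>\<^bsub>M\<^esub> g \<otimes>\<^bsub>M\<^esub> inv\<^bsub>M\<^esub> a \<in> ball i (a v)"
  using assms(2,3)
proof (induction i arbitrary: v)
  case 0
  then show ?case using assms(1) by (simp add: ball_0 stab_conj)
next
  case (Suc i)
  have "a \<otimes>\<^bsub>M\<^esub> g \<otimes>\<^bsub>M\<^esub> inv\<^bsub>M\<^esub> a \<in> ball i u" if u: "u \<in> neighbours D (a v)" for u
  proof -
    have uV: "u \<in> verts D" using u by (rule neighbours_verts)
    have "(inv\<^bsub>M\<^esub> a) u \<in> neighbours D ((inv\<^bsub>M\<^esub> a) (a v))"
      using neighbours_act[OF _ u] assms(1) by simp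
    then have w: "(inv\<^bsub>M\<^esub> a) u \<in> neighbours D v" using assms(1) Suc.prems by simp
    then have "a \<otimes>\<^bsub>M\<^esub> g \<otimes>\<^bsub>M\<^esub> inv\<^bsub>M\<^esub> a \<in> ball i (a ((inv\<^bsub>M\<^esub> a) u))"
      using Suc neighbours_verts(1)[OF w] by (intro Suc.IH) (simp_all add: ball_Suc)
    then show ?thesis using assms(1) uV by simp
  qed
  then show ?case using Suc.prems assms(1) by (simp add: ball_Suc stab_conj)
qed

lemma ball_conj_iff:
  assumes a: "a \<in> G" and v: "v \<in> verts D" and g: "g \<in> G"
  shows "inv\<^bsub>M\<^esub> a \<otimes>\<^bsub>M\<^esub> g \<otimes>\<^bsub>M\<^esub> a \<in> ball i v \<longleftrightarrow> g \<in> ball i (a v)"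
proof
  have c: "a \<in> carrier M" "g \<in> carrier M" using a g by simp_all
  assume "inv\<^bsub>M\<^esub> a \<otimes>\<^bsub>M\<^esub> g \<otimes>\<^bsub>M\<^esub> a \<in> ball i v"
  from ball_conj[OF a v this] show "g \<in> ball i (a v)"
    using c by (simp add: M.word_simps)
next
  have c: "a \<in> carrier M" "g \<in> carrier M" using a g by simp_all
  assume "g \<in> ball i (a v)"
  from ball_conj[OF _ _ this, of "inv\<^bsub>M\<^esub> a"] show "inv\<^bsub>M\<^esub> a \<otimes>\<^bsub>M\<^esub> g \<otimes>\<^bsub>M\<^esub> a \<in> ball i v"
    using a v c by simp
qed

lemma ball_1_normal:
  assumes v: "v \<in> verts D"
  shows "ball 1 v \<lhd> M\<lparr>carrier := stab G v\<rparr>"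
proof -
  have "subgroup (ball 1 v) M"
  proof (rule M.subgroupI)
    have "\<one>\<^bsub>M\<^esub> \<in> ball 1 v"
      using v subgroup.one_closed[OF stab_subgroup[OF v]] neighbours_verts(1)[of _ v] by (simp add: ball_Suc_0)
    then show "ball 1 v \<noteq> {}" by blast
    fix g assume g: "g \<in> ball 1 v"
    have "(inv\<^bsub>M\<^esub> g) u = u" if u: "u \<in> neighbours D v" for u
    proof -
      have "g \<in> G" "g u = u" "u \<in> verts D" using g u v neighbours_verts(1)[OF u] by (auto simp: ball_Suc_0 stab_def)
      then show ?thesis using act_inv(1)[of g u] by simp
    qed
    then show "inv\<^bsub>M\<^esub> g \<in> ball 1 v"
      using g v subgroup.m_inv_closed[OF stab_subgroup[OF v]] by (simp add: ball_Suc_0)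
    fix h assume h: "h \<in> ball 1 v"
    show "g \<otimes>\<^bsub>M\<^esub> h \<in> ball 1 v"
      using g h v subgroup.m_closed[OF stab_subgroup[OF v]] neighbours_verts(1)[of _ v]
      by (auto simp: ball_Suc_0 stabD)
  next
    show "ball 1 v \<subseteq> carrier M" using ball_le_stab stab_subgroup[OF v] subgroup.subset by blast
  qed
  moreover have "a \<otimes>\<^bsub>M\<^esub> g \<otimes>\<^bsub>M\<^esub> inv\<^bsub>M\<^esub> a \<in> ball 1 v" if "a \<in> stab G v" "g \<in> ball 1 v" for a g
    using ball_conj[OF _ v that(2), of a] that(1) stabD by metis
  ultimately show ?thesis
    using ball_le_stab by (auto simp: M.normal_in_iff[OF stab_subgroup[OF v]])
qed

section \<open>The two stabilisers of an arc as an amalgam\<close>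

text \<open>The stabiliser of \<open>x\<close> moves \<open>y\<close> to every neighbour
  \<open>u\<close> of \<open>x\<close>, so the condition on all conjugates says that
  \<open>k\<close> lies in \<open>ball 1 u\<close> for each such \<open>u\<close>.\<close>

lemma core2_eq_ball:
  assumes y: "y \<in> neighbours D x"
  shows "M.core2 (stab G x) (ball 1 x) (ball 1 y) = ball 2 x"
proof -
  have x: "x \<in> verts D" and yV: "y \<in> verts D" using neighbours_verts[OF y] by blast+
  have 2: "ball 2 x = {g \<in> stab G x. \<forall>u\<in>neighbours D x. g \<in> ball 1 u}"
    using ball_Suc[OF x, of 1] by (simp add: numeral_2_eq_2)
  show ?thesis
  proof (rule equalityI; rule subsetI)
    fix k assume k: "k \<in> M.core2 (stab G x) (ball 1 x) (ball 1 y)"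
    then have kx: "k \<in> stab G x" using ball_le_stab by (auto simp: M.core2_def)
    have "k \<in> ball 1 u" if u: "u \<in> neighbours D x" for u
    proof -
      obtain a where a: "a \<in> stab G x" "a y = u" using locally_trans[OF x y u] by blast
      then have "inv\<^bsub>M\<^esub> a \<in> stab G x" using subgroup.m_inv_closed[OF stab_subgroup[OF x]] by blast
      then have "inv\<^bsub>M\<^esub> a \<otimes>\<^bsub>M\<^esub> k \<otimes>\<^bsub>M\<^esub> inv\<^bsub>M\<^esub> (inv\<^bsub>M\<^esub> a) \<in> ball 1 y"
        using k by (simp add: M.core2_def)
      then have "inv\<^bsub>M\<^esub> a \<otimes>\<^bsub>M\<^esub> k \<otimes>\<^bsub>M\<^esub> a \<in> ball 1 y" using stabD(1)[OF a(1)] by simp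
      then show ?thesis using ball_conj_iff[OF stabD(1)[OF a(1)] yV stabD(1)[OF kx]] a(2) by simp
    qed
    then show "k \<in> ball 2 x" using kx 2 by simp
  next
    fix k assume k: "k \<in> ball 2 x"
    have "a \<otimes>\<^bsub>M\<^esub> k \<otimes>\<^bsub>M\<^esub> inv\<^bsub>M\<^esub> a \<in> ball 1 y" if a: "a \<in> stab G x" for a
      using ball_conj[OF stabD(1)[OF a] x k] stabD(2)[OF a] 2 y by simp
    then show "k \<in> M.core2 (stab G x) (ball 1 x) (ball 1 y)"
      using k ball_antimono[of 1 2 x] by (auto simp: M.core2_def)
  qed
qed

text \<open>The stabiliser of \<open>y\<close> moves \<open>x\<close> to every neighbour
  \<open>u\<close> of \<open>y\<close>, so the hypothesis also holds with \<open>u\<close> for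
  \<open>x\<close>. An element of \<open>ball 2 y\<close> lies in
  \<open>ball 1 u \<inter> ball 1 y\<close>, hence in \<open>ball 2 u\<close>.\<close>

lemma ball_2_eq_ball_3:
  assumes y: "y \<in> neighbours D x" and eq: "ball 1 x \<inter> ball 1 y = ball 2 x"
  shows "ball 2 y = ball 3 y"
proof
  show "ball 3 y \<subseteq> ball 2 y" by (rule ball_antimono) simp
  have yx: "x \<in> neighbours D y" using y neighbours_sym by blast
  have x: "x \<in> verts D" and yV: "y \<in> verts D" using neighbours_verts[OF y] by blast+
  have 2: "ball 2 y = {g \<in> stab G y. \<forall>u\<in>neighbours D y. g \<in> ball 1 u}"
    using ball_Suc[OF yV, of 1] by (simp add: numeral_2_eq_2)
  have 3: "ball 3 y = {g \<in> stab G y. \<forall>u\<in>neighbours D y. g \<in> ball 2 u}"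
    using ball_Suc[OF yV, of 2] by (simp add: numeral_3_eq_3 numeral_2_eq_2)
  show "ball 2 y \<subseteq> ball 3 y"
  proof
    fix g assume g: "g \<in> ball 2 y"
    then have gy: "g \<in> stab G y" using ball_le_stab by blast
    have "g \<in> ball 2 u" if u: "u \<in> neighbours D y" for u
    proof -
      obtain b where b: "b \<in> stab G y" "b x = u" using locally_trans[OF yV yx u] by blast
      have "inv\<^bsub>M\<^esub> b \<otimes>\<^bsub>M\<^esub> g \<otimes>\<^bsub>M\<^esub> b \<in> ball 2 y"
        using ball_conj_iff[OF stabD(1)[OF b(1)] yV stabD(1)[OF gy]] stabD(2)[OF b(1)] g by simp
      then have "inv\<^bsub>M\<^esub> b \<otimes>\<^bsub>M\<^esub> g \<otimes>\<^bsub>M\<^esub> b \<in> ball 1 x \<inter> ball 1 y"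
        using 2 yx ball_antimono[of 1 2 y] by auto
      then show ?thesis
        using ball_conj_iff[OF stabD(1)[OF b(1)] x stabD(1)[OF gy], of 2] b(2) unfolding eq by simp
    qed
    then show "g \<in> ball 3 y" using gy 3 by simp
  qed
qed

text \<open>By local transitivity and connectedness every vertex has the form \<open>e x\<close> or
  \<open>e y\<close> with \<open>e\<close> a product of elements of the two stabilisers. These
  normalise \<open>N\<close>, and \<open>N\<close> fixes \<open>x\<close> and \<open>y\<close>, so
  it fixes every vertex.\<close>

lemma faithful:
  assumes y: "y \<in> neighbours D x"
    and N: "N \<lhd> M\<lparr>carrier := stab G x\<rparr>" "N \<lhd> M\<lparr>carrier := stab G y\<rparr>"
  shows "N = {\<one>\<^bsub>M\<^esub>}"
proof -
  have yx: "x \<in> neighbours D y" using y neighbours_sym by blast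
  have x: "x \<in> verts D" and yV: "y \<in> verts D" using neighbours_verts[OF y] by blast+
  note Nx = M.normal_in_iff[THEN iffD1, OF stab_subgroup[OF x] N(1)]
  note Ny = M.normal_in_iff[THEN iffD1, OF stab_subgroup[OF yV] N(2)]
  define P where "P e \<longleftrightarrow> e \<in> G \<and> (\<forall>n\<in>N. inv\<^bsub>M\<^esub> e \<otimes>\<^bsub>M\<^esub> n \<otimes>\<^bsub>M\<^esub> e \<in> N)" for e
  have NG: "n \<in> G" if "n \<in> N" for n using that Nx stabD(1) by blast
  have P_mult: "P (e \<otimes>\<^bsub>M\<^esub> a)" if e: "P e" and a: "a \<in> stab G x \<or> a \<in> stab G y" for e a
  proof -
    have aG: "a \<in> G" using a stabD by blast
    have "inv\<^bsub>M\<^esub> (e \<otimes>\<^bsub>M\<^esub> a) \<otimes>\<^bsub>M\<^esub> n \<otimes>\<^bsub>M\<^esub> (e \<otimes>\<^bsub>M\<^esub> a) \<in> N" if n: "n \<in> N" for n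
    proof -
      have "inv\<^bsub>M\<^esub> a \<in> stab G x \<or> inv\<^bsub>M\<^esub> a \<in> stab G y"
        using a subgroup.m_inv_closed[OF stab_subgroup] x yV by blast
      moreover have "inv\<^bsub>M\<^esub> e \<otimes>\<^bsub>M\<^esub> n \<otimes>\<^bsub>M\<^esub> e \<in> N" using e n by (simp add: P_def)
      ultimately have "inv\<^bsub>M\<^esub> a \<otimes>\<^bsub>M\<^esub> (inv\<^bsub>M\<^esub> e \<otimes>\<^bsub>M\<^esub> n \<otimes>\<^bsub>M\<^esub> e) \<otimes>\<^bsub>M\<^esub> inv\<^bsub>M\<^esub> (inv\<^bsub>M\<^esub> a) \<in> N"
        using Nx Ny by blast
      moreover have "e \<in> carrier M" "a \<in> carrier M" "n \<in> carrier M"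
        using e aG NG[OF n] by (simp_all add: P_def)
      ultimately show ?thesis by (simp add: M.word_simps)
    qed
    then show ?thesis using e aG by (simp add: P_def)
  qed
  \<comment> \<open>One step along an edge: \<open>w\<close> is pulled back by \<open>e\<close> to a
    neighbour of \<open>x'\<close>, and an element of the stabiliser of \<open>x'\<close> takes
    \<open>y'\<close> there.\<close>
  have adv: "\<exists>e'. P e' \<and> w = e' y'" if e: "P e" and w: "w \<in> neighbours D (e x')"
    and xy: "(x' = x \<and> y' = y) \<or> (x' = y \<and> y' = x)" for e x' y' w
  proof -
    have x': "x' \<in> verts D" "y' \<in> neighbours D x'" "y' \<in> verts D" using xy x yV y yx by auto
    have eG: "e \<in> G" using e by (simp add: P_def)
    have wV: "w \<in> verts D" using w by (rule neighbours_verts)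
    have "(inv\<^bsub>M\<^esub> e) w \<in> neighbours D ((inv\<^bsub>M\<^esub> e) (e x'))"
      using neighbours_act[OF _ w] eG by simp
    then have "(inv\<^bsub>M\<^esub> e) w \<in> neighbours D x'" using eG x' by simp
    then obtain a where a: "a \<in> stab G x'" "a y' = (inv\<^bsub>M\<^esub> e) w"
      using locally_trans[OF x'(1,2)] by blast
    have "(e \<otimes>\<^bsub>M\<^esub> a) y' = w" using a eG wV x' stabD(1)[OF a(1)] by simp
    then show ?thesis using P_mult[OF e] a(1) xy by blast
  qed
  have "symmetric D" by (rule sym_arcs)
  have reach: "x \<rightarrow>\<^sup>*\<^bsub>D\<^esub> v" if "v \<in> verts D" for v
    using symmetric_connected_imp_strongly_connected[OF \<open>symmetric D\<close> connected] x that
    by (auto simp: strongly_connected_def)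
  have "P \<one>\<^bsub>M\<^esub>" using NG by (auto simp: P_def)
  have orbit: "\<exists>e. P e \<and> (v = e x \<or> v = e y)" if "x \<rightarrow>\<^sup>*\<^bsub>D\<^esub> v" for v
    using that
  proof (induction rule: reachable_induct)
    case base
    then show ?case using \<open>P \<one>\<^bsub>M\<^esub>\<close> act_one[OF x] by metis
  next
    case (step v w)
    then have "w \<in> neighbours D v" by (simp add: neighbours_def)
    with step.IH show ?case using adv by metis
  qed
  have "n = \<one>\<^bsub>M\<^esub>" if n: "n \<in> N" for n
  proof (rule act_ext[OF NG[OF n]])
    fix v assume "v \<in> verts D"
    then obtain e x' where e: "P e" "v = e x'" "x' = x \<or> x' = y" using orbit reach by metis
    let ?m = "inv\<^bsub>M\<^esub> e \<otimes>\<^bsub>M\<^esub> n \<otimes>\<^bsub>M\<^esub> e"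
    have m: "?m \<in> N" "e \<in> G" using e(1) n by (auto simp: P_def)
    have x': "x' \<in> verts D" "?m x' = x'" using e(3) x yV m(1) Nx Ny stabD(2) by blast+
    have "e (?m x') = n (e x')" using x'(1) m(2) NG[OF n] by simp
    then show "n v = v" using x'(2) e(2) by simp
  qed
  then show ?thesis using Nx subgroup.one_closed by blast
qed

lemma amalgam:
  assumes y: "y \<in> neighbours D x"
  shows "amalgam M (stab G x) (stab G y) (ball 1 x) (ball 1 y)"
proof (intro amalgam.intro amalgam_axioms.intro M.group_axioms finite_M)
  have yx: "x \<in> neighbours D y" using y neighbours_sym by blast
  have x: "x \<in> verts D" and yV: "y \<in> verts D" using neighbours_verts[OF y] by blast+
  show "subgroup (stab G x) M" "subgroup (stab G y) M" using x yV by (simp_all add: stab_subgroup)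
  show "ball 1 x \<lhd> M\<lparr>carrier := stab G x\<rparr>" "ball 1 y \<lhd> M\<lparr>carrier := stab G y\<rparr>"
    using ball_1_normal x yV by blast+
  show "ball 1 x \<subseteq> stab G y" "ball 1 y \<subseteq> stab G x"
    unfolding ball_1[OF x] ball_1[OF yV] using y yx by (auto simp: stab_def)
  show "N = {\<one>\<^bsub>M\<^esub>}" if "N \<lhd> M\<lparr>carrier := stab G x\<rparr>" "N \<lhd> M\<lparr>carrier := stab G y\<rparr>" for N
    using faithful[OF y that] .
qed

section \<open>Conditions (i) and (ii) as statements about subgroups\<close>

text \<open>Frattini argument: choose \<open>g\<close> in \<open>X\<close> agreeing with
  \<open>a\<close> at \<open>y\<close>; then \<open>g^-1 a\<close> fixes \<open>y\<close>.\<close>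

lemma transitive_perm_factorises:
  assumes y: "y \<in> neighbours D x" and X: "X \<subseteq> stab G x"
    and tr: "transitive_perm (induced X (neighbours D x)) (neighbours D x)"
  shows "stab G x \<subseteq> X <#>\<^bsub>M\<^esub> (stab G x \<inter> stab G y)"
proof
  have x: "x \<in> verts D" and yV: "y \<in> verts D" using neighbours_verts[OF y] by blast+
  interpret S: subgroup "stab G x" M using x by (rule stab_subgroup)
  fix a assume a: "a \<in> stab G x"
  have "a y \<in> neighbours D x" using neighbours_act[OF stabD(1)[OF a] y] stabD(2)[OF a] by simp
  then obtain g where "g \<in> induced X (neighbours D x)" "g y = a y"
    using transitive_action.unique_orbit[OF tr[unfolded transitive_perm_def] y] by auto
  then obtain g where g: "g \<in> X" "g y = a y" using y by (auto simp: induced_def)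
  let ?h = "inv\<^bsub>M\<^esub> g \<otimes>\<^bsub>M\<^esub> a"
  have gS: "g \<in> stab G x" using g X by blast
  then have "?h \<in> stab G x" using a by blast
  moreover have "(inv\<^bsub>M\<^esub> g) (g y) = y" using act_inv(1)[OF stabD(1)[OF gS] yV] .
  then have "?h y = y" using g(2) stabD(1)[OF gS] stabD(1)[OF a] yV by simp
  ultimately have "?h \<in> stab G x \<inter> stab G y" by (simp add: stab_def)
  moreover have "a = g \<otimes>\<^bsub>M\<^esub> ?h" using gS a by simp
  ultimately show "a \<in> X <#>\<^bsub>M\<^esub> (stab G x \<inter> stab G y)"
    using g(1) unfolding set_mult_def by blast
qed

lemma semiregular_perm_le_ball:
  assumes y: "y \<in> neighbours D x" and X: "X \<subseteq> stab G x"
    and sr: "semiregular_perm (induced X (neighbours D x)) (neighbours D x)"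
  shows "X \<inter> stab G y \<subseteq> ball 1 x"
proof
  have x: "x \<in> verts D" using neighbours_verts[OF y] by blast
  fix g assume g: "g \<in> X \<inter> stab G y"
  let ?r = "restrict g (neighbours D x)"
  have "?r \<in> induced X (neighbours D x)" "?r y = y" using g y by (auto simp: induced_def stab_def)
  then have r: "?r = \<one>\<^bsub>BijGroup (neighbours D x)\<^esub>" using sr y unfolding semiregular_perm_def by blast
  have "g u = u" if u: "u \<in> neighbours D x" for u
  proof -
    have "?r u = u" unfolding r using u by (simp add: BijGroup_def)
    then show ?thesis using u by simp
  qed
  then show "g \<in> ball 1 x" using g X unfolding ball_1[OF x] by blast
qed

text \<open>An element of the stabiliser of \<open>x\<close> taking \<open>y\<close> to
  \<open>w\<close> conjugates \<open>G\<^sub>x\<^sub>,\<^sub>y\<close> to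
  \<open>G\<^sub>x\<^sub>,\<^sub>w\<close> and therefore one \<open>O\<^sub>q\<close> to the
  other.\<close>

lemma p_core_arc_stab:
  assumes y: "y \<in> neighbours D x" and w: "w \<in> neighbours D x" and q: "prime q"
  shows "p_core q (perm_group (verts D) (arc_stab G x w)) \<subseteq> M.core_conjs q (stab G x) (stab G x \<inter> stab G y)"
proof
  have x: "x \<in> verts D" and yV: "y \<in> verts D" and wV: "w \<in> verts D"
    using neighbours_verts[OF y] neighbours_verts[OF w] by blast+
  interpret S: subgroup "stab G x" M using x by (rule stab_subgroup)
  obtain a where a: "a \<in> stab G x" "a y = w" using locally_trans[OF x y w] by blast
  have aG: "a \<in> G" and ax: "a x = x" using stabD[of a x] a by auto
  have iG: "inv\<^bsub>M\<^esub> a \<in> G" using aG by simp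
  have iw: "(inv\<^bsub>M\<^esub> a) w = y" and ix: "(inv\<^bsub>M\<^esub> a) x = x"
    using act_inv(1)[OF aG yV] act_inv(1)[OF aG x] a(2) ax by simp_all
  have H: "subgroup (stab G x \<inter> stab G y) M" "subgroup (stab G x \<inter> stab G w) M"
    using stab_subgroup[OF x] stab_subgroup[OF yV] stab_subgroup[OF wV] by (auto intro: M.subgroups_Inter_pair)
  fix u assume "u \<in> p_core q (perm_group (verts D) (arc_stab G x w))"
  then have u: "u \<in> M.Op q (stab G x \<inter> stab G w)" by (simp add: arc_stab_def)
  have "inv\<^bsub>M\<^esub> a \<otimes>\<^bsub>M\<^esub> u \<otimes>\<^bsub>M\<^esub> inv\<^bsub>M\<^esub> (inv\<^bsub>M\<^esub> a) \<in> M.Op q (stab G x \<inter> stab G y)"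
  proof (rule M.p_core_conj[OF finite_M q H(2,1) _ _ _ u])
    show "inv\<^bsub>M\<^esub> a \<in> carrier M" using aG by simp
    show "inv\<^bsub>M\<^esub> a \<otimes>\<^bsub>M\<^esub> k \<otimes>\<^bsub>M\<^esub> inv\<^bsub>M\<^esub> (inv\<^bsub>M\<^esub> a) \<in> stab G x \<inter> stab G y"
      if "k \<in> stab G x \<inter> stab G w" for k
      using stab_conj[OF iG _ x, of k] stab_conj[OF iG _ wV, of k] that unfolding ix iw by blast
    show "inv\<^bsub>M\<^esub> (inv\<^bsub>M\<^esub> a) \<otimes>\<^bsub>M\<^esub> k \<otimes>\<^bsub>M\<^esub> inv\<^bsub>M\<^esub> a \<in> stab G x \<inter> stab G w"
      if "k \<in> stab G x \<inter> stab G y" for k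
      using stab_conj[OF aG _ x, of k] stab_conj[OF aG _ yV, of k] that aG unfolding ax a(2) by simp
  qed
  then have "a \<otimes>\<^bsub>M\<^esub> (inv\<^bsub>M\<^esub> a \<otimes>\<^bsub>M\<^esub> u \<otimes>\<^bsub>M\<^esub> inv\<^bsub>M\<^esub> (inv\<^bsub>M\<^esub> a)) \<otimes>\<^bsub>M\<^esub> inv\<^bsub>M\<^esub> a
      \<in> M.core_conjs q (stab G x) (stab G x \<inter> stab G y)"
    using a(1) unfolding M.core_conjs_def by blast
  moreover have "u \<in> carrier M"
    using subgroup.mem_carrier[OF M.p_core_in_subgroup(1)[OF finite_M q H(2)] u] .
  ultimately show "u \<in> M.core_conjs q (stab G x) (stab G x \<inter> stab G y)"
    using aG by (simp add: M.word_simps)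
qed

lemma centraliser_alternative:
  assumes y: "y \<in> neighbours D x"
    and i: "let X = centraliser (perm_group (verts D) (stab G x)) (ball_stab D G 1 x); S = neighbours D x
      in transitive_perm (induced X S) S \<or> semiregular_perm (induced X S) S"
  shows "stab G x \<subseteq> amalgam.C M (stab G x) (ball 1 x) <#>\<^bsub>M\<^esub> (stab G x \<inter> stab G y) \<or>
    amalgam.C M (stab G x) (ball 1 x) \<inter> stab G y \<subseteq> ball 1 x"
proof -
  interpret amalgam M "stab G x" "stab G y" "ball 1 x" "ball 1 y" using y by (rule amalgam)
  have "centraliser (perm_group (verts D) (stab G x)) (ball 1 x) = C"
    unfolding centraliser_def C_def by simp
  moreover have "C \<subseteq> stab G x" unfolding C_def by blast
  ultimately show ?thesis
    using i transitive_perm_factorises[OF y] semiregular_perm_le_ball[OF y] unfolding Let_def by metis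
qed

text \<open>In the transitive case the generated group lies in the one of \<open>trans_at\<close>,
  which is enough for the factorisation. In the semiregular case the term for \<open>w = y\<close>
  shows that it contains \<open>O\<^sub>q(H)\<close>.\<close>

lemma p_core_alternative:
  assumes y: "y \<in> neighbours D x" and q: "prime q"
    and ii: "let S = neighbours D x;
        X = generate (perm_group (verts D) G) (\<Union>w\<in>S. p_core q (perm_group (verts D) (arc_stab G x w)))
      in transitive_perm (induced X S) S \<or> semiregular_perm (induced X S) S"
  shows "amalgam.trans_at M (stab G x) (stab G y) q \<or> M.Op q (stab G x \<inter> stab G y) \<subseteq> ball 1 x"
proof -
  interpret amalgam M "stab G x" "stab G y" "ball 1 x" "ball 1 y" using y by (rule amalgam)
  let ?T = "\<Union>w\<in>neighbours D x. p_core q (perm_group (verts D) (arc_stab G x w))"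
  have le: "?T \<subseteq> M.core_conjs q (stab G x) (stab G x \<inter> stab G y)"
    using p_core_arc_stab[OF y _ q] by blast
  have "?T \<subseteq> G" using le core_conjs_le[OF q] by (auto simp: stab_def)
  then have eq: "generate (perm_group (verts D) G) ?T = generate M ?T"
    using G by (rule M.generate_consistent)
  have sub: "generate M ?T \<subseteq> generate M (M.core_conjs q (stab G x) (stab G x \<inter> stab G y))"
    using le by (rule M.mono_generate)
  have X: "generate M ?T \<subseteq> stab G x"
    using M.generate_subgroup_incl[OF _ A] le core_conjs_le[OF q] by blast
  from ii consider
    "transitive_perm (induced (generate M ?T) (neighbours D x)) (neighbours D x)" |
    "semiregular_perm (induced (generate M ?T) (neighbours D x)) (neighbours D x)"
    unfolding Let_def eq by blast
  then show ?thesis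
  proof cases
    case 1
    then have "stab G x \<subseteq> generate M ?T <#>\<^bsub>M\<^esub> (stab G x \<inter> stab G y)"
      using y X by (intro transitive_perm_factorises)
    also have "\<dots> \<subseteq> generate M (M.core_conjs q (stab G x) (stab G x \<inter> stab G y)) <#>\<^bsub>M\<^esub> (stab G x \<inter> stab G y)"
      using sub by (auto simp: set_mult_def)
    finally show ?thesis unfolding trans_at_def by blast
  next
    case 2
    have "M.Op q (stab G x \<inter> stab G y) \<subseteq> ?T"
      unfolding arc_stab_def using y by blast
    then have "M.Op q (stab G x \<inter> stab G y) \<subseteq> generate M ?T" by (blast intro: generate.incl)
    moreover have "M.Op q (stab G x \<inter> stab G y) \<subseteq> stab G y"
      using M.p_core_in_subgroup(2)[OF finite_M q H] by blast
    ultimately show ?thesis using semiregular_perm_le_ball[OF y X 2] by blast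
  qed
qed

end

theorem theorem2:
  fixes D :: "('a, 'b) pre_digraph" and G :: "('a \<Rightarrow> 'a) set" and x y :: 'a
  assumes "graph D" and "connected D"
    and "subgroup G (perm_group (verts D) (graph_auto D))"
    and "\<And>v. v \<in> verts D \<Longrightarrow> transitive_perm (induced (stab G v) (neighbours D v)) (neighbours D v)"
    and "\<And>v. v \<in> verts D \<Longrightarrow>
      (let X = centraliser (perm_group (verts D) (stab G v)) (ball_stab D G 1 v);
           S = neighbours D v
       in transitive_perm (induced X S) S \<or> semiregular_perm (induced X S) S)"
    and "\<And>v q. v \<in> verts D \<Longrightarrow> prime (q::nat) \<Longrightarrow>
      (let S = neighbours D v;
           X = generate (perm_group (verts D) G)
                 (\<Union>w\<in>S. p_core q (perm_group (verts D) (arc_stab G v w)))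
       in transitive_perm (induced X S) S \<or> semiregular_perm (induced X S) S)"
    and "x \<rightarrow>\<^bsub>D\<^esub> y"
  shows "\<exists>p::nat. prime p \<and>
    (p_group p (perm_group (verts D) (arc_kernel D G x y)) \<or>
     (\<exists>(a, b) \<in> {(x, y), (y, x)}.
        arc_kernel D G a b = ball_stab D G 2 a \<and>
        ball_stab D G 2 b = ball_stab D G 3 b \<and>
        p_group p (perm_group (verts D) (ball_stab D G 2 b)))) \<and>
    (p_group p (perm_group (verts D)
        (generalised_fitting (perm_group (verts D) (arc_stab G x y)))) \<or>
     (\<exists>(a, b) \<in> {(x, y), (y, x)}.
        arc_kernel D G a b = ball_stab D G 2 a \<and>
        ball_stab D G 2 b = {\<one>\<^bsub>BijGroup (verts D)\<^esub>}))"
proof -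
  interpret locally_transitive D G
  proof (intro locally_transitive.intro locally_transitive_axioms.intro assms(1-3))
    fix v w w' assume v: "v \<in> verts D" "w \<in> neighbours D v" "w' \<in> neighbours D v"
    obtain g where "g \<in> induced (stab G v) (neighbours D v)" "g w = w'"
      using transitive_action.unique_orbit[OF assms(4)[OF v(1), unfolded transitive_perm_def] v(2,3)] by auto
    then show "\<exists>g\<in>stab G v. g w = w'" using v(2) by (auto simp: induced_def)
  qed
  have y: "y \<in> neighbours D x" using assms(7) by (simp add: neighbours_def)
  then have x: "x \<in> neighbours D y" using neighbours_sym by blast
  have V: "x \<in> verts D" "y \<in> verts D" using neighbours_verts[OF y] by blast+
  interpret amalgam M "stab G x" "stab G y" "ball 1 x" "ball 1 y" using y by (rule amalgam)
  have comm: "stab G y \<inter> stab G x = stab G x \<inter> stab G y" "ball 1 y \<inter> ball 1 x = ball 1 x \<inter> ball 1 y" by blast+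
  have "\<exists>p. prime p \<and> conclusion1 p \<and> conclusion2 p"
    using local_alternative centraliser_alternative[OF y assms(5)[OF V(1)]]
      centraliser_alternative[OF x assms(5)[OF V(2)], unfolded comm]
      p_core_alternative[OF y _ assms(6)[OF V(1)]]
      p_core_alternative[OF x _ assms(6)[OF V(2)], unfolded comm] by blast
  then obtain p where p: "prime p" "conclusion1 p" "conclusion2 p" by blast
  have ker: "arc_kernel D G x y = ball 1 x \<inter> ball 1 y" "arc_kernel D G y x = ball 1 x \<inter> ball 1 y"
    by (auto simp: arc_kernel_def)
  \<comment> \<open>This supplies the equality of balls of radius 2 and 3, which
    \<open>conclusion1\<close> omits.\<close>
  have ball3: "ball 1 x \<inter> ball 1 y = ball 2 x \<Longrightarrow> ball 2 y = ball 3 y"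
    "ball 1 x \<inter> ball 1 y = ball 2 y \<Longrightarrow> ball 2 x = ball 3 x"
    using ball_2_eq_ball_3[OF y] ball_2_eq_ball_3[OF x, unfolded comm] by blast+
  note core2 = core2_eq_ball[OF y] core2_eq_ball[OF x]
  have ex: "(\<exists>(a, b) \<in> {(x, y), (y, x)}. Q a b) \<longleftrightarrow> Q x y \<or> Q y x" for Q by auto
  show ?thesis
    using p ball3 unfolding conclusion1_def conclusion2_def core2 ker ex arc_stab_def by blast
qed

end
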